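(* Let $q\in\mathbb{Q}$ be nonzero and let $m\in\mathbb{Q}$ with $m\neq 0$ and $m\neq q^2$. Let $(x_1,y_1)\in\mathcal{D}_m(\mathbb{Q})$ be the point used to define the birational map $f\colon\mathcal{D}_m\to E_m$, and let $g$ be the associated function on $E_m$ (all as in the context). If $(Q_1,Q_2,Q_3)\in E_m(\mathbb{Q})^3$ is a triple satisfying the non-degeneracy criteria such that $(y_1^2-q)\cdot g(Q_1+Q_2+Q_3)$ is a square in $\mathbb{Q}$, then the numbers $$a=\pm\left(\frac{1}{m}\,\frac{g(Q_1)}{x_1^2-q}\,\frac{g(Q_2)}{x_1^2-q}\,\frac{g(Q_3)}{x_1^2-q}\right)^{1/2},\qquad b=\frac{g(Q_1)}{a(x_1^2-q)},\quad c=\frac{g(Q_2)}{a(x_1^2-q)},\quad d=\frac{g(Q_3)}{a(x_1^2-q)}$$ are rational and form a rational $D(q)$-quadruple with $abcd=m$. Conversely, assume $(a,b,c,d)$ is a rational $D(q)$-quadruple with $abcd=m$. If the triple $(Q_1,Q_2,Q_3)\in E_m(\mathbb{Q})^3$ corresponds to $(a,b,c,d)$, then $(y_1^2-q)\,g(Q_1+Q_2+Q_3)$ is a square in $\mathbb{Q}$.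
   Context: For nonzero $q\in\mathbb{Q}$, a rational $D(q)$-quadruple is a set of four distinct nonzero rationals $\{a,b,c,d\}$ such that the product of any two distinct elements plus $q$ is a square of a rational number. For rational $m\neq 0,q^2$ let $\mathcal{D}_m\colon (X^2-q)(Y^2-q)=m$ (a genus one curve), with projective closure $\overline{\mathcal{D}}_m\colon (X^2-qZ^2)(Y^2-qZ^2)=mZ^4$, and let $E_m\colon W^2=T^3+(4q^2-2m)T^2+m^2T$. Fix a point $(x_1,y_1)\in\mathcal{D}_m(\mathbb{Q})$. The birational map $f\colon\mathcal{D}_m\to E_m$ is $T=(y_1^2-q)\cdot\frac{2x_1(y^2-q)x+(x_1^2+q)y^2+x_1^2y_1^2-2x_1^2q-y_1^2q}{(y-y_1)^2}$, $W=T\cdot\frac{2y_1x(q-y^2)+2x_1y(q-y_1^2)}{y^2-y_1^2}$; it sends $(x_1,y_1)$ to the point at infinity $\mathcal{O}$. Its inverse $f^{-1}\colon E_m\to\overline{\mathcal{D}}_m$ is a morphism; write $x\circ f^{-1}(P)=X(f^{-1}(P))/Z(f^{-1}(P))$ and similarly $y\circ f^{-1}$. Define $g\colon E_m\to\mathbb{A}^1$ by $g(P)=(x_1^2-q)\big((x\circ f^{-1}(P))^2-q\big)$. Let $R=(m,2mq)\in E_m(\mathbb{Q})$ (a point of order $4$, equal to $f(-y_1,x_1)$) and $S=f(-x_1,y_1)=\left(\frac{y_1^2(x_1^2-q)^2}{x_1^2},\frac{qy_1(x_1^2+y_1^2)(x_1^2-q)^2}{x_1^3}\right)$. If $f(x,y)=P$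 then $f(-x,y)=S-P$ and $f(-y,x)=P+R$. Let $G$ be the group of maps of $E_m$ generated by $P\mapsto S-P$ and $P\mapsto P+R$ (isomorphic to $\mathbb{Z}/2\times\mathbb{Z}/4$). A triple $(Q_1,Q_2,Q_3)$ satisfies the non-degeneracy criteria if the orbits $G\cdot Q_1,G\cdot Q_2,G\cdot Q_3$ are pairwise disjoint. A triple $(Q_1,Q_2,Q_3)$ corresponds to a $D(q)$-quadruple $(a,b,c,d)$ if $Q_1=f(t_{12},t_{34})$, $Q_2=f(t_{13},t_{24})$, $Q_3=f(t_{14},t_{23})$ for rationals $t_{ij}$ with $ab+q=t_{12}^2$, $ac+q=t_{13}^2$, $ad+q=t_{14}^2$, $bc+q=t_{23}^2$, $bd+q=t_{24}^2$, $cd+q=t_{34}^2$.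
   Formalization: It is assumed in addition that each g(Q_i) is finite and nonzero (first part) and that g(Q_1+Q_2+Q_3) is finite (both parts); otherwise b, c, d or the square condition are undefined. This is automatic unless q is a square. *)

theory Defs
  imports Complex_Main "HOL-Computational_Algebra.Nth_Powers"
begin

definition is_Dq_quadruple :: "rat \<Rightarrow> rat \<Rightarrow> rat \<Rightarrow> rat \<Rightarrow> rat \<Rightarrow> bool" where
  "is_Dq_quadruple q a b c d \<longleftrightarrow>
     distinct [a, b, c, d] \<and> 0 \<notin> {a, b, c, d} \<and>
     (\<forall>u\<in>{a, b, c, d}. \<forall>v\<in>{a, b, c, d}. u \<noteq> v \<longrightarrow> is_square (u * v + q))"

definition D_points :: "rat \<Rightarrow> rat \<Rightarrow> (rat \<times> rat) set" where
  "D_points q m = {(x, y). (x\<^sup>2 - q) * (y\<^sup>2 - q) = m}"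

subsection \<open>Rational points of \<open>E\<^sub>m : W\<^sup>2 = T\<^sup>3 + (4q\<^sup>2 - 2m) T\<^sup>2 + m\<^sup>2 T\<close> and the chord-tangent law\<close>

datatype ec_point = Infinity | Point rat rat

definition E_points :: "rat \<Rightarrow> rat \<Rightarrow> ec_point set" where
  "E_points q m =
     insert Infinity {Point T W | T W. W\<^sup>2 = T ^ 3 + (4 * q\<^sup>2 - 2 * m) * T\<^sup>2 + m\<^sup>2 * T}"

fun ec_neg :: "ec_point \<Rightarrow> ec_point" where
  "ec_neg Infinity = Infinity"
| "ec_neg (Point T W) = Point T (- W)"

fun ec_add :: "rat \<Rightarrow> rat \<Rightarrow> ec_point \<Rightarrow> ec_point \<Rightarrow> ec_point" where
  "ec_add q m Infinity P = P"
| "ec_add q m P Infinity = P"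
| "ec_add q m (Point T1 W1) (Point T2 W2) =
     (if T1 = T2 \<and> W1 = - W2 then Infinity
      else
        let l = (if T1 = T2
                 then (3 * T1\<^sup>2 + 2 * (4 * q\<^sup>2 - 2 * m) * T1 + m\<^sup>2) / (2 * W1)
                 else (W2 - W1) / (T2 - T1));
            T3 = l\<^sup>2 - (4 * q\<^sup>2 - 2 * m) - T1 - T2
        in Point T3 (l * (T1 - T3) - W1))"

definition ec_sub :: "rat \<Rightarrow> rat \<Rightarrow> ec_point \<Rightarrow> ec_point \<Rightarrow> ec_point" where
  "ec_sub q m P Q = ec_add q m P (ec_neg Q)"

subsection \<open>The map \<open>f\<close>, its inverse, and \<open>g\<close>\<close>

text \<open>
  \<open>E\<^sub>m\<close> is the smooth model of the projective closure of \<open>D\<^sub>m\<close>, whose only singular points are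
  the two points at infinity \<open>[1:0:0]\<close> and \<open>[0:1:0]\<close>.  Each of them has two branches, defined over
  the field generated by a square root of \<open>q\<close>:
  \<open>X_inf e\<close> is the place over \<open>[1:0:0]\<close> with \<open>x = \<infinity>, y = e\<close>, and
  \<open>Y_inf e\<close> is the place over \<open>[0:1:0]\<close> with \<open>x = e, y = \<infinity>\<close>, where \<open>e\<^sup>2 = q\<close>.
  They are rational only when \<open>q\<close> is a square.
\<close>

datatype place = Affine rat rat | X_inf rat | Y_inf rat

definition D_places :: "rat \<Rightarrow> rat \<Rightarrow> place set" where
  "D_places q m =
     {Affine x y | x y. (x, y) \<in> D_points q m} \<union> X_inf ` {e. e\<^sup>2 = q} \<union> Y_inf ` {e. e\<^sup>2 = q}"

text \<open>
  The first branch below is the formula defining the birational map \<open>f\<close>.  The remaining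
  values are those of its unique extension to a morphism on the smooth model.  If \<open>(x, y)\<close> lies on
  \<open>D\<^sub>m\<close> and \<open>y\<^sup>2 = y1\<^sup>2\<close> then \<open>x = \<plusminus>x1\<close>, and the extension takes the values
  \<open>f(x1, y1) = \<O>\<close>, \<open>f(-x1, y1) = S\<close>, \<open>f(-x1, -y1) = 2R = (0, 0)\<close>, \<open>f(x1, -y1) = S + 2R\<close>.
  At the places at infinity the values are the limits of the formula as \<open>y \<rightarrow> \<infinity>, x \<rightarrow> e\<close> and as
  \<open>x \<rightarrow> \<infinity>, y \<rightarrow> e\<close>, simplified with \<open>e\<^sup>2 = q\<close>.
\<close>

fun f_map :: "rat \<Rightarrow> rat \<Rightarrow> rat \<Rightarrow> place \<Rightarrow> ec_point" where
  "f_map q x1 y1 (Affine x y) =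
     (if y\<^sup>2 \<noteq> y1\<^sup>2 then
        let T = (y1\<^sup>2 - q) *
                ((2 * x1 * (y\<^sup>2 - q) * x + (x1\<^sup>2 + q) * y\<^sup>2 + x1\<^sup>2 * y1\<^sup>2 - 2 * x1\<^sup>2 * q - y1\<^sup>2 * q)
                  / (y - y1)\<^sup>2);
            W = T * ((2 * y1 * x * (q - y\<^sup>2) + 2 * x1 * y * (q - y1\<^sup>2)) / (y\<^sup>2 - y1\<^sup>2))
        in Point T W
      else if y = y1 then
        (if x = x1 then Infinity
         else Point (y1\<^sup>2 * (x1\<^sup>2 - q)\<^sup>2 / x1\<^sup>2)
                    (q * y1 * (x1\<^sup>2 + y1\<^sup>2) * (x1\<^sup>2 - q)\<^sup>2 / x1 ^ 3))
      else
        (if x = - x1 then Point 0 0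
         else Point (x1\<^sup>2 * (y1\<^sup>2 - q)\<^sup>2 / y1\<^sup>2)
                    (- (q * x1 * (x1\<^sup>2 + y1\<^sup>2) * (y1\<^sup>2 - q)\<^sup>2 / y1 ^ 3))))"
| "f_map q x1 y1 (X_inf e) =
     (let T = (x1\<^sup>2 - q) * (y1 + e)\<^sup>2 in Point T (2 * x1 * e * T))"
| "f_map q x1 y1 (Y_inf e) =
     (let T = (y1\<^sup>2 - q) * (x1 + e)\<^sup>2 in Point T (- 2 * y1 * e * T))"

fun x_coord :: "place \<Rightarrow> rat option" where
  "x_coord (Affine x y) = Some x"
| "x_coord (X_inf e) = None"
| "x_coord (Y_inf e) = Some e"

text \<open>
  The value of the rational function \<open>X/Z\<close> at a place is meant here: at \<open>Y_inf e\<close> the coordinates of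
  \<open>[0:1:0]\<close> give \<open>0/0\<close>, but \<open>X/Z\<close> is regular there with value \<open>e\<close>, so that \<open>g\<close> vanishes.
  For \<open>(x1, y1)\<close> on \<open>D\<^sub>m\<close>, \<open>f\<close> is a bijection from the rational places of \<open>D\<^sub>m\<close> onto \<open>E\<^sub>m(\<rat>)\<close>, so
  on \<open>E\<^sub>m(\<rat>)\<close> the value \<open>None\<close> means precisely that \<open>x \<circ> f\<^sup>-\<^sup>1\<close> has a pole.  In particular there are
  no such points when \<open>q\<close> is not a square.
\<close>

definition x_f_inv :: "rat \<Rightarrow> rat \<Rightarrow> rat \<Rightarrow> rat \<Rightarrow> ec_point \<Rightarrow> rat option" where
  "x_f_inv q m x1 y1 P =
     (if P \<in> f_map q x1 y1 ` D_places q m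
      then x_coord (inv_into (D_places q m) (f_map q x1 y1) P) else None)"

definition g_map :: "rat \<Rightarrow> rat \<Rightarrow> rat \<Rightarrow> rat \<Rightarrow> ec_point \<Rightarrow> rat option" where
  "g_map q m x1 y1 P = map_option (\<lambda>x. (x1\<^sup>2 - q) * (x\<^sup>2 - q)) (x_f_inv q m x1 y1 P)"

subsection \<open>The group \<open>G\<close>, non-degeneracy, and correspondence\<close>

definition R_point :: "rat \<Rightarrow> rat \<Rightarrow> ec_point" where
  "R_point q m = Point m (2 * m * q)"

text \<open>For \<open>x1 = 0\<close> the explicit coordinates of \<open>S\<close> are meaningless, and \<open>S = f(0, y1) = \<O>\<close>.\<close>

definition S_point :: "rat \<Rightarrow> rat \<Rightarrow> rat \<Rightarrow> ec_point" where
  "S_point q x1 y1 = f_map q x1 y1 (Affine (- x1) y1)"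

text \<open>The map \<open>P \<mapsto> S - P\<close> is its own inverse on \<open>E\<^sub>m\<close>, and \<open>P \<mapsto> P - R\<close> is inverse to \<open>P \<mapsto> P + R\<close>.\<close>

inductive_set G_maps :: "rat \<Rightarrow> rat \<Rightarrow> rat \<Rightarrow> rat \<Rightarrow> (ec_point \<Rightarrow> ec_point) set"
  for q m x1 y1 :: rat where
  "id \<in> G_maps q m x1 y1"
| "h \<in> G_maps q m x1 y1 \<Longrightarrow> (\<lambda>P. ec_sub q m (S_point q x1 y1) (h P)) \<in> G_maps q m x1 y1"
| "h \<in> G_maps q m x1 y1 \<Longrightarrow> (\<lambda>P. ec_add q m (h P) (R_point q m)) \<in> G_maps q m x1 y1"
| "h \<in> G_maps q m x1 y1 \<Longrightarrow> (\<lambda>P. ec_sub q m (h P) (R_point q m)) \<in> G_maps q m x1 y1"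

definition G_orbit :: "rat \<Rightarrow> rat \<Rightarrow> rat \<Rightarrow> rat \<Rightarrow> ec_point \<Rightarrow> ec_point set" where
  "G_orbit q m x1 y1 P = {h P | h. h \<in> G_maps q m x1 y1}"

definition nondegenerate ::
    "rat \<Rightarrow> rat \<Rightarrow> rat \<Rightarrow> rat \<Rightarrow> ec_point \<Rightarrow> ec_point \<Rightarrow> ec_point \<Rightarrow> bool" where
  "nondegenerate q m x1 y1 Q1 Q2 Q3 \<longleftrightarrow>
     G_orbit q m x1 y1 Q1 \<inter> G_orbit q m x1 y1 Q2 = {} \<and>
     G_orbit q m x1 y1 Q1 \<inter> G_orbit q m x1 y1 Q3 = {} \<and>
     G_orbit q m x1 y1 Q2 \<inter> G_orbit q m x1 y1 Q3 = {}"

definition corresponds_to ::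
    "rat \<Rightarrow> rat \<Rightarrow> rat \<Rightarrow> ec_point \<Rightarrow> ec_point \<Rightarrow> ec_point \<Rightarrow>
     rat \<Rightarrow> rat \<Rightarrow> rat \<Rightarrow> rat \<Rightarrow> bool" where
  "corresponds_to q x1 y1 Q1 Q2 Q3 a b c d \<longleftrightarrow>
     (\<exists>t12 t13 t14 t23 t24 t34.
        a * b + q = t12\<^sup>2 \<and> a * c + q = t13\<^sup>2 \<and> a * d + q = t14\<^sup>2 \<and>
        b * c + q = t23\<^sup>2 \<and> b * d + q = t24\<^sup>2 \<and> c * d + q = t34\<^sup>2 \<and>
        Q1 = f_map q x1 y1 (Affine t12 t34) \<and>
        Q2 = f_map q x1 y1 (Affine t13 t24) \<and>
        Q3 = f_map q x1 y1 (Affine t14 t23))"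

end

theory Submission
  imports Defs
begin

text \<open>
  On the image of \<open>f\<close> the abscissa factors as
  \<open>T = (y1\<^sup>2 - q) (y\<^sup>2 - q) ((x + x1) / (y - y1))\<^sup>2\<close>, so that \<open>T g\<close> is a square. Since \<open>T\<close> induces a
  homomorphism modulo squares (three collinear points satisfy \<open>T1 T2 T3 = c\<^sup>2\<close> for the intercept
  \<open>c\<close> of their line), \<open>(y1\<^sup>2 - q) g(Q1 + Q2 + Q3)\<close> is a square if and only if
  \<open>(y1\<^sup>2 - q) g(Q1) g(Q2) g(Q3)\<close> is one, that is, if and only if \<open>a\<close> is rational. The products of
  \<open>a, b, c, d\<close> in pairs are then \<open>x\<^sub>i\<^sup>2 - q\<close> and \<open>y\<^sub>i\<^sup>2 - q\<close> with \<open>Q\<^sub>i = f(x\<^sub>i, y\<^sub>i)\<close>. Two equal entries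
  would make some \<open>(x\<^sub>j, y\<^sub>j)\<close> agree with \<open>(x\<^sub>i, y\<^sub>i)\<close> up to signs and order, and then \<open>Q\<^sub>i\<close> and \<open>Q\<^sub>j\<close>
  lie in the same orbit of \<open>G\<close>. Injectivity of \<open>f\<close> is never needed: \<open>g\<close> is evaluated at some
  preimage, and \<open>T\<close> does not depend on the choice.
\<close>

subsection \<open>Translation by the point of order four\<close>

text \<open>The hypotheses are Vieta's relations for the three intersections of the cubic with the line
  \<open>W = l T + c\<close>, counted with multiplicity. Stating them in full makes chord and tangent a single case,
  and a vertical line is excluded because a point \<open>W = 0\<close> of multiplicity two would be
  singular.\<close>

lemma ec_add_collinear:
  fixes q m :: rat
  assumes nonsing: "q \<noteq> 0" "m \<noteq> 0" "m \<noteq> q\<^sup>2"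
    and s1: "t1 + t2 + t3 = l\<^sup>2 - (4 * q\<^sup>2 - 2 * m)"
    and s2: "t1 * t2 + t1 * t3 + t2 * t3 = m\<^sup>2 - 2 * l * c"
    and s3: "t1 * t2 * t3 = c\<^sup>2"
    and w: "w1 = l * t1 + c" "w2 = l * t2 + c" "w3 = - (l * t3 + c)"
  shows "ec_add q m (Point t1 w1) (Point t2 w2) = Point t3 w3"
proof -
  have t3: "l\<^sup>2 - (4 * q\<^sup>2 - 2 * m) - t1 - t2 = t3"
    using s1 by simp
  have w3: "l * (t1 - t3) - w1 = w3"
    using w by (simp add: algebra_simps)
  show ?thesis
  proof (cases "t1 = t2")
    case False
    have "w2 - w1 = l * (t2 - t1)"
      using w by (simp add: algebra_simps)
    then have "(w2 - w1) / (t2 - t1) = l"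
      using False by simp
    with False show ?thesis
      by (simp only: ec_add.simps Let_def t3 w3 if_False simp_thms)
  next
    case True
    have w1: "w1 = w2" using True w by simp
    have d: "3 * t1\<^sup>2 + 2 * (4 * q\<^sup>2 - 2 * m) * t1 + m\<^sup>2 = 2 * w1 * l"
      using s1 s2 s3 w True by algebra
    have "w1 \<noteq> 0"
    proof
      assume "w1 = 0"
      then have "3 * t1\<^sup>2 + 2 * (4 * q\<^sup>2 - 2 * m) * t1 + m\<^sup>2 = 0"
        using d by simp
      moreover have "t1 ^ 3 + (4 * q\<^sup>2 - 2 * m) * t1\<^sup>2 + m\<^sup>2 * t1 = 0"
        using \<open>w1 = 0\<close> s1 s2 s3 w True by algebra
      \<comment> \<open>Up to the factor 16, the left side is the discriminant of the cubic.\<close>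
      ultimately have "m ^ 4 * q\<^sup>2 * (q\<^sup>2 - m) = 0"
        by algebra
      with nonsing show False by simp
    qed
    then have l: "(3 * t1\<^sup>2 + 2 * (4 * q\<^sup>2 - 2 * m) * t1 + m\<^sup>2) / (2 * w1) = l"
      using d by (simp add: field_simps)
    have "w1 \<noteq> - w2" using w1 \<open>w1 \<noteq> 0\<close> by simp
    then show ?thesis
      by (simp only: ec_add.simps Let_def l t3 w3 eqTrueI[OF True] if_False if_True simp_thms)
  qed
qed

section \<open>The factored form of f and its rotation at generic points\<close>

text \<open>On the curve \<open>(y^2 - q) x^2\<close> equals \<open>m + q (y^2 - q)\<close>, which
  turns the long numerator of \<open>T\<close> into \<open>(y^2 - q) (x + x1)^2\<close>.\<close>

lemma f_map_affine_generic:
  assumes "(x1, y1) \<in> D_points q m" "(x, y) \<in> D_points q m" "y\<^sup>2 \<noteq> y1\<^sup>2"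
  defines "T \<equiv> (y\<^sup>2 - q) * (y1\<^sup>2 - q) * ((x + x1) / (y - y1))\<^sup>2"
  shows "f_map q x1 y1 (Affine x y) =
    Point T (T * (- 2 * (y1 * x * (y\<^sup>2 - q) + x1 * y * (y1\<^sup>2 - q)) / ((y - y1) * (y + y1))))"
proof -
  have D: "(x\<^sup>2 - q) * (y\<^sup>2 - q) = (x1\<^sup>2 - q) * (y1\<^sup>2 - q)"
    using assms by (simp add: D_points_def)
  have "2 * x1 * (y\<^sup>2 - q) * x + (x1\<^sup>2 + q) * y\<^sup>2 + x1\<^sup>2 * y1\<^sup>2 - 2 * x1\<^sup>2 * q - y1\<^sup>2 * q
      = (y\<^sup>2 - q) * (x + x1)\<^sup>2"
    using D by algebra
  then have "(y1\<^sup>2 - q) *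
      ((2 * x1 * (y\<^sup>2 - q) * x + (x1\<^sup>2 + q) * y\<^sup>2 + x1\<^sup>2 * y1\<^sup>2 - 2 * x1\<^sup>2 * q - y1\<^sup>2 * q)
        / (y - y1)\<^sup>2) = T"
    by (simp add: T_def power_divide mult_ac)
  moreover have "2 * y1 * x * (q - y\<^sup>2) + 2 * x1 * y * (q - y1\<^sup>2)
      = - 2 * (y1 * x * (y\<^sup>2 - q) + x1 * y * (y1\<^sup>2 - q))"
    by algebra
  moreover have "y\<^sup>2 - y1\<^sup>2 = (y - y1) * (y + y1)"
    by algebra
  ultimately show ?thesis
    using assms(3) by (simp only: f_map.simps Let_def if_True simp_thms)
qed

text \<open>Every non-vertical line through \<open>R\<close> is \<open>W = (2q - e) T + m e\<close>.\<close>

lemma ec_add_R: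
  fixes q m :: rat
  assumes nonsing: "q \<noteq> 0" "m \<noteq> 0" "m \<noteq> q\<^sup>2"
    and prod: "t1 * t2 = m * e\<^sup>2"
    and sum: "t1 + t2 + m = (2 * q - e)\<^sup>2 - (4 * q\<^sup>2 - 2 * m)"
    and w: "w1 = (2 * q - e) * t1 + m * e" "w2 = - ((2 * q - e) * t2 + m * e)"
  shows "ec_add q m (Point t1 w1) (R_point q m) = Point t2 w2"
  unfolding R_point_def
proof (rule ec_add_collinear[where l = "2 * q - e" and c = "m * e"])
  show "t1 + m + t2 = (2 * q - e)\<^sup>2 - (4 * q\<^sup>2 - 2 * m)"
    using sum by simp
  show "t1 * m + t1 * t2 + m * t2 = m\<^sup>2 - 2 * (2 * q - e) * (m * e)"
    using sum prod by algebra
  show "t1 * m * t2 = (m * e)\<^sup>2"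
    using prod by algebra
  show "2 * m * q = (2 * q - e) * m + m * e"
    by algebra
qed (use nonsing w in auto)

text \<open>With \<open>u = y\<^sup>2 - q\<close>, \<open>U = x\<^sup>2 - q\<close>, \<open>v = y1\<^sup>2 - q\<close>, \<open>p = y - y1\<close>, \<open>n = y + y1\<close>, \<open>r = x - y1\<close>,
  \<open>k = x + y1\<close>, \<open>X = x + x1\<close> and \<open>Y = x1 - y\<close>, the summand and the sum are \<open>f(x, y)\<close> and \<open>f(-y, x)\<close>; the
  line through the former and \<open>R\<close> has \<open>e = v (X/p) (Y/r)\<close>, found from the requirement that the
  product of the three abscissae be the square of the intercept.\<close>

lemma ec_add_R_fractions:
  fixes q m :: rat
  assumes nonsing: "q \<noteq> 0" "m \<noteq> 0" "m \<noteq> q\<^sup>2"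
    and m: "m = U * u"
    and nz: "p \<noteq> 0" "r \<noteq> 0" "n \<noteq> 0" "k \<noteq> 0"
    and sum: "u * v * X\<^sup>2 * r\<^sup>2 + U * v * Y\<^sup>2 * p\<^sup>2 + m * p\<^sup>2 * r\<^sup>2 =
      (2 * q * p * r - v * X * Y)\<^sup>2 - (4 * q\<^sup>2 - 2 * m) * p\<^sup>2 * r\<^sup>2"
    and N: "- 2 * N * r * X = ((2 * q * p * r - v * X * Y) * X + U * Y * p\<^sup>2) * n"
    and M: "2 * M * p * Y = ((2 * q * p * r - v * X * Y) * Y + u * X * r\<^sup>2) * k"
  shows "ec_add q m (Point (u * v * (X / p)\<^sup>2) (u * v * (X / p)\<^sup>2 * (- 2 * N / (p * n)))) (R_point q m) =
    Point (U * v * (Y / r)\<^sup>2) (U * v * (Y / r)\<^sup>2 * (- 2 * M / (r * k)))"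
proof -
  \<comment> \<open>The quotients become variables tied by \<open>s * p = X\<close> and
    \<open>t * r = Y\<close>. Each identity is then polynomial once multiplied by a denominator,
    which is cancelled afterwards.\<close>
  define s where "s = X / p"
  define t where "t = Y / r"
  have X: "X = s * p" and Y: "Y = t * r"
    using nz by (auto simp: s_def t_def)
  have "(u * v * s\<^sup>2 + U * v * t\<^sup>2 + m - ((2 * q - v * s * t)\<^sup>2 - (4 * q\<^sup>2 - 2 * m))) * p\<^sup>2 * r\<^sup>2 = 0"
    using sum unfolding X Y by algebra
  then have sum': "u * v * s\<^sup>2 + U * v * t\<^sup>2 + m = (2 * q - v * s * t)\<^sup>2 - (4 * q\<^sup>2 - 2 * m)"
    using nz by simp
  define W where "W = - 2 * N / (p * n)"
  have W: "W * (p * n) = - 2 * N"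
    using nz by (simp add: W_def)
  \<comment> \<open>This is the line equation at the first point with the factor
    \<open>u * v * s\<close> removed, by \<open>m = U * u\<close>. At the second point the factor is
    \<open>U * v * t\<close>.\<close>
  have "(W * s - ((2 * q - v * s * t) * s + U * t)) * (p\<^sup>2 * r * n) = 0"
    using N W unfolding X Y by algebra
  then have W': "W * s = (2 * q - v * s * t) * s + U * t"
    using nz by simp
  define Z where "Z = - 2 * M / (r * k)"
  have Z: "Z * (r * k) = - 2 * M"
    using nz by (simp add: Z_def)
  have "(- Z * t - ((2 * q - v * s * t) * t + u * s)) * (r\<^sup>2 * p * k) = 0"
    using M Z unfolding X Y by algebra
  then have Z': "- Z * t = (2 * q - v * s * t) * t + u * s"
    using nz by simp
  show ?thesis
    unfolding s_def[symmetric] t_def[symmetric] W_def[symmetric] Z_def[symmetric]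
  proof (rule ec_add_R[OF nonsing _ sum'])
    show "u * v * s\<^sup>2 * (U * v * t\<^sup>2) = m * (v * s * t)\<^sup>2"
      using m by algebra
    show "u * v * s\<^sup>2 * W = (2 * q - v * s * t) * (u * v * s\<^sup>2) + m * (v * s * t)"
      using W' m by algebra
    show "U * v * t\<^sup>2 * Z = - ((2 * q - v * s * t) * (U * v * t\<^sup>2) + m * (v * s * t))"
      using Z' m by algebra
  qed
qed

text \<open>If neither \<open>(x, y)\<close> nor \<open>(-y, x)\<close> is exceptional, both values
  have the factored form and only polynomial identities modulo the curve equation remain.\<close>

lemma f_map_rotate_generic:
  assumes nonsing: "q \<noteq> 0" "m \<noteq> 0" "m \<noteq> q\<^sup>2"
    and D1: "(x1, y1) \<in> D_points q m" and D: "(x, y) \<in> D_points q m"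
    and ne: "y\<^sup>2 \<noteq> y1\<^sup>2" "x\<^sup>2 \<noteq> y1\<^sup>2"
  shows "f_map q x1 y1 (Affine (- y) x) = ec_add q m (f_map q x1 y1 (Affine x y)) (R_point q m)"
proof -
  have D': "(- y, x) \<in> D_points q m"
    using D by (simp add: D_points_def mult.commute)
  have m: "m = (x\<^sup>2 - q) * (y\<^sup>2 - q)"
    using D by (simp add: D_points_def)
  have H: "(x\<^sup>2 - q) * (y\<^sup>2 - q) = (x1\<^sup>2 - q) * (y1\<^sup>2 - q)"
    using D D1 by (simp add: D_points_def)
  have nz: "y - y1 \<noteq> 0" "y + y1 \<noteq> 0" "x - y1 \<noteq> 0" "x + y1 \<noteq> 0"
    using ne by (auto simp: add_eq_0_iff)
  show ?thesis
    unfolding f_map_affine_generic[OF D1 D ne(1)] f_map_affine_generic[OF D1 D' ne(2)]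
  proof (rule ec_add_R_fractions[symmetric, OF nonsing m nz(1,3,2,4)])
    show "(y\<^sup>2 - q) * (y1\<^sup>2 - q) * (x + x1)\<^sup>2 * (x - y1)\<^sup>2 +
      (x\<^sup>2 - q) * (y1\<^sup>2 - q) * (- y + x1)\<^sup>2 * (y - y1)\<^sup>2 + m * (y - y1)\<^sup>2 * (x - y1)\<^sup>2 =
      (2 * q * (y - y1) * (x - y1) - (y1\<^sup>2 - q) * (x + x1) * (- y + x1))\<^sup>2 -
      (4 * q\<^sup>2 - 2 * m) * (y - y1)\<^sup>2 * (x - y1)\<^sup>2"
      unfolding m using H by algebra
    show "- 2 * (y1 * x * (y\<^sup>2 - q) + x1 * y * (y1\<^sup>2 - q)) * (x - y1) * (x + x1) =
      ((2 * q * (y - y1) * (x - y1) - (y1\<^sup>2 - q) * (x + x1) * (- y + x1)) * (x + x1) +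
        (x\<^sup>2 - q) * (- y + x1) * (y - y1)\<^sup>2) * (y + y1)"
      using H by algebra
    show "2 * (y1 * (- y) * (x\<^sup>2 - q) + x1 * x * (y1\<^sup>2 - q)) * (y - y1) * (- y + x1) =
      ((2 * q * (y - y1) * (x - y1) - (y1\<^sup>2 - q) * (x + x1) * (- y + x1)) * (- y + x1) +
        (y\<^sup>2 - q) * (x + x1) * (x - y1)\<^sup>2) * (x + y1)"
      using H by algebra
  qed
qed

text \<open>The line \<open>W = 2 q T\<close> is tangent to the curve at R and passes through the
  origin.\<close>

lemma ec_add_R_R:
  assumes nonsing: "q \<noteq> 0" "m \<noteq> 0" "m \<noteq> q\<^sup>2"
  shows "ec_add q m (R_point q m) (R_point q m) = Point 0 0"
  unfolding R_point_def
  by (rule ec_add_collinear[where l = "2 * q" and c = 0])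
    (use nonsing in \<open>auto simp: power2_eq_square\<close>)

text \<open>The same tangent read from the origin: its third intersection is R again, so the sum is
  -R.\<close>

lemma ec_add_two_torsion_R:
  assumes nonsing: "q \<noteq> 0" "m \<noteq> 0" "m \<noteq> q\<^sup>2"
  shows "ec_add q m (Point 0 0) (R_point q m) = Point m (- 2 * m * q)"
  unfolding R_point_def
  by (rule ec_add_collinear[where l = "2 * q" and c = 0])
    (use nonsing in \<open>auto simp: power2_eq_square\<close>)

section \<open>Values at exceptional points and rotation in general\<close>

lemma D_points_swap: "(x, y) \<in> D_points q m \<Longrightarrow> (y, x) \<in> D_points q m"
  and D_points_minus_left: "(x, y) \<in> D_points q m \<Longrightarrow> (- x, y) \<in> D_points q m"
  and D_points_minus_right: "(x, y) \<in> D_points q m \<Longrightarrow> (x, - y) \<in> D_points q m"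
  by (simp_all add: D_points_def mult.commute)

text \<open>At generic position the quotient \<open>(x + x1) / (y - y1)\<close> is 1 or -1 at these
  points, so the abscissa is \<open>(x1^2 - q) (y1^2 - q) = m\<close>.\<close>

lemma f_map_R:
  assumes "m \<noteq> 0" "m \<noteq> q\<^sup>2" and D1: "(x1, y1) \<in> D_points q m"
  shows "f_map q x1 y1 (Affine (- y1) x1) = Point m (2 * m * q)" (is ?A)
    and "f_map q x1 y1 (Affine y1 (- x1)) = Point m (- 2 * m * q)" (is ?B)
proof -
  have m: "m = (x1\<^sup>2 - q) * (y1\<^sup>2 - q)"
    using D1 by (simp add: D_points_def)
  have "?A \<and> ?B"
  proof (cases "x1\<^sup>2 = y1\<^sup>2")
    case True
    \<comment> \<open>Here the explicit branches of \<open>f_map\<close> apply. Vanishing of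
      \<open>y1\<close> would force \<open>x1 = 0\<close> and then \<open>m = q^2\<close>.\<close>
    then have "y1 \<noteq> 0"
      using m \<open>m \<noteq> q\<^sup>2\<close> by (auto simp: power2_eq_square)
    moreover from True have "x1 = y1 \<or> x1 = - y1"
      by (simp add: power2_eq_iff)
    ultimately show ?thesis
      using m by (elim disjE) (auto simp: power2_eq_square power3_eq_cube)
  next
    case False
    then have nz: "x1 - y1 \<noteq> 0" "x1 + y1 \<noteq> 0"
      by (auto simp: add_eq_0_iff)
    have "- 2 * (y1 * - y1 * (x1\<^sup>2 - q) + x1 * x1 * (y1\<^sup>2 - q)) =
        2 * q * ((x1 - y1) * (x1 + y1))"
      by algebra
    then have "- 2 * (y1 * - y1 * (x1\<^sup>2 - q) + x1 * x1 * (y1\<^sup>2 - q)) / ((x1 - y1) * (x1 + y1)) =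
        2 * q"
      using nz by simp
    moreover have "- 2 * (y1 * y1 * ((- x1)\<^sup>2 - q) + x1 * - x1 * (y1\<^sup>2 - q)) =
        - 2 * q * ((- x1 - y1) * (- x1 + y1))"
      by algebra
    then have "- 2 * (y1 * y1 * ((- x1)\<^sup>2 - q) + x1 * - x1 * (y1\<^sup>2 - q)) /
        ((- x1 - y1) * (- x1 + y1)) = - 2 * q"
      using nz by simp
    moreover have "(- y1 + x1) / (x1 - y1) = 1" "(y1 + x1) / (- x1 - y1) = -1"
      using nz by (auto simp: divide_eq_eq)
    moreover have "(- x1)\<^sup>2 \<noteq> y1\<^sup>2"
      using False by simp
    ultimately show ?thesis
      unfolding f_map_affine_generic[OF D1 D_points_minus_left[OF D_points_swap[OF D1]] False]
       f_map_affine_generic[OF D1 D_points_minus_right[OF D_points_swap[OF D1]] \<open>(- x1)\<^sup>2 \<noteq> y1\<^sup>2\<close>]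
      using m by simp
  qed
  then show ?A ?B by simp_all
qed

text \<open>For \<open>(a, b) = (x1, y1)\<close> the two points are \<open>f(y1, x1)\<close> and \<open>S\<close>; the other points \<open>f(\<plusminus>y1, \<plusminus>x1)\<close>
  with \<open>x\<^sup>2 = y1\<^sup>2\<close> and their images under \<open>P \<mapsto> P + R\<close> arise by swapping \<open>a\<close> and \<open>b\<close> or changing signs.\<close>

lemma ec_add_R_swap:
  fixes a b :: rat
  assumes nonsing: "q \<noteq> 0" "m \<noteq> 0" "m \<noteq> q\<^sup>2"
    and m: "m = (a\<^sup>2 - q) * (b\<^sup>2 - q)"
    and ab: "a \<noteq> 0" "a\<^sup>2 \<noteq> b\<^sup>2"
  defines "t1 \<equiv> m * ((a + b) / (a - b))\<^sup>2"
    and "t2 \<equiv> b\<^sup>2 * (a\<^sup>2 - q)\<^sup>2 / a\<^sup>2"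
    and "w \<equiv> - 2 * (b\<^sup>2 * (a\<^sup>2 - q) + a\<^sup>2 * (b\<^sup>2 - q)) / ((a - b) * (a + b))"
    and "w2 \<equiv> q * b * (a\<^sup>2 + b\<^sup>2) * (a\<^sup>2 - q)\<^sup>2 / a ^ 3"
  shows "ec_add q m (Point t1 (t1 * w)) (R_point q m) = Point t2 w2"
    and "ec_add q m (Point t2 (- w2)) (R_point q m) = Point t1 (- (t1 * w))"
proof -
  have nz: "a - b \<noteq> 0" "a + b \<noteq> 0"
    using ab by (auto simp: add_eq_0_iff)
  \<comment> \<open>Since \<open>t1 = m s^2\<close> and \<open>t2 = k^2\<close>, the intercept whose
    square is \<open>m t1 t2\<close> is \<open>m k s\<close> up to sign; hence
    \<open>e = k s\<close> in \<open>ec_add_R\<close>.\<close>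
  define s where "s = (a + b) / (a - b)"
  define k where "k = b * (a\<^sup>2 - q) / a"
  have s: "s * (a - b) = a + b" and k: "k * a = b * (a\<^sup>2 - q)"
    and w: "w * ((a - b) * (a + b)) = - 2 * (b\<^sup>2 * (a\<^sup>2 - q) + a\<^sup>2 * (b\<^sup>2 - q))"
    using ab nz by (simp_all add: s_def k_def w_def)
  have t1: "t1 = m * s\<^sup>2" and t2: "t2 = k\<^sup>2"
    by (simp_all add: t1_def s_def t2_def k_def power_mult_distrib power_divide)
  have w2: "w2 * a\<^sup>2 = q * k * (a\<^sup>2 + b\<^sup>2) * (a\<^sup>2 - q)"
    using ab by (simp add: w2_def k_def field_simps power2_eq_square power3_eq_cube)
  have prod: "t1 * t2 = m * (k * s)\<^sup>2"
    by (simp add: t1 t2 power_mult_distrib)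
  have "(m * s\<^sup>2 + k\<^sup>2 + m - ((2 * q - k * s)\<^sup>2 - (4 * q\<^sup>2 - 2 * m))) * ((a - b)\<^sup>2 * a\<^sup>2) = 0"
    using s k unfolding m by algebra
  then have sum: "t1 + t2 + m = (2 * q - k * s)\<^sup>2 - (4 * q\<^sup>2 - 2 * m)"
    using ab nz by (simp add: t1 t2)
  have "(s * w - ((2 * q - k * s) * s + k)) * ((a - b)\<^sup>2 * a) = 0"
    using s k w by algebra
  then have "s * w = (2 * q - k * s) * s + k"
    using ab nz by simp
  then have w1': "t1 * w = (2 * q - k * s) * t1 + m * (k * s)"
    unfolding t1 by algebra
  have "(w2 + ((2 * q - k * s) * t2 + m * (k * s))) * ((a - b) * a\<^sup>2) = 0"
    using s k w2 unfolding t2 m by algebra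
  then have w2': "w2 = - ((2 * q - k * s) * t2 + m * (k * s))"
    using ab nz by (simp add: eq_neg_iff_add_eq_0)
  show "ec_add q m (Point t1 (t1 * w)) (R_point q m) = Point t2 w2"
    by (rule ec_add_R[OF nonsing prod sum w1' w2'])
  show "ec_add q m (Point t2 (- w2)) (R_point q m) = Point t1 (- (t1 * w))"
    by (rule ec_add_R[OF nonsing, where e = "k * s"])
      (use prod sum w1' w2' in \<open>simp_all add: mult.commute add.commute\<close>)
qed

text \<open>This puts the values in the shape of \<open>ec_add_R_swap\<close>: changing both signs
  inverts the quotient in the abscissa and negates \<open>w\<close>.\<close>

lemma f_map_swap:
  assumes D1: "(x1, y1) \<in> D_points q m" and ne: "x1\<^sup>2 \<noteq> y1\<^sup>2"
  defines "w \<equiv> - 2 * (y1\<^sup>2 * (x1\<^sup>2 - q) + x1\<^sup>2 * (y1\<^sup>2 - q)) / ((x1 - y1) * (x1 + y1))"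
    and "t1 \<equiv> m * ((x1 + y1) / (x1 - y1))\<^sup>2"
    and "t2 \<equiv> m * ((x1 - y1) / (x1 + y1))\<^sup>2"
  shows "f_map q x1 y1 (Affine y1 x1) = Point t1 (t1 * w)"
    and "f_map q x1 y1 (Affine (- y1) (- x1)) = Point t2 (- (t2 * w))"
proof -
  have m: "(x1\<^sup>2 - q) * (y1\<^sup>2 - q) = m"
    using D1 by (simp add: D_points_def)
  have D2: "(y1, x1) \<in> D_points q m"
    by (rule D_points_swap[OF D1])
  have nz: "x1 - y1 \<noteq> 0" "x1 + y1 \<noteq> 0"
    using ne by (auto simp: add_eq_0_iff)
  have T1: "(x1\<^sup>2 - q) * (y1\<^sup>2 - q) * ((y1 + x1) / (x1 - y1))\<^sup>2 = t1"
    by (simp add: t1_def m add.commute)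
  show "f_map q x1 y1 (Affine y1 x1) = Point t1 (t1 * w)"
    unfolding f_map_affine_generic[OF D1 D2 ne] T1 w_def
    by (simp only: power2_eq_square)
  have ne': "(- x1)\<^sup>2 \<noteq> y1\<^sup>2"
    using ne by simp
  have n: "- y1 + x1 = x1 - y1" "- x1 - y1 = - (x1 + y1)"
    by simp_all
  have s: "(- y1 + x1) / (- x1 - y1) = - ((x1 - y1) / (x1 + y1))"
    by (simp only: n minus_divide_right)
  have T2: "((- x1)\<^sup>2 - q) * (y1\<^sup>2 - q) * ((- y1 + x1) / (- x1 - y1))\<^sup>2 = t2"
    unfolding s by (simp add: t2_def m)
  have "(- x1 - y1) * (- x1 + y1) = (x1 - y1) * (x1 + y1)"
    "y1 * - y1 * ((- x1)\<^sup>2 - q) + x1 * - x1 * (y1\<^sup>2 - q) =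
     - (y1\<^sup>2 * (x1\<^sup>2 - q) + x1\<^sup>2 * (y1\<^sup>2 - q))"
    by (simp_all add: algebra_simps power2_eq_square)
  then have W2: "- 2 * (y1 * - y1 * ((- x1)\<^sup>2 - q) + x1 * - x1 * (y1\<^sup>2 - q)) /
      ((- x1 - y1) * (- x1 + y1)) = - w"
    by (simp only: w_def)
  show "f_map q x1 y1 (Affine (- y1) (- x1)) = Point t2 (- (t2 * w))"
    unfolding f_map_affine_generic[OF D1 D_points_minus_left[OF D_points_minus_right[OF D2]] ne'] T2 W2
    by simp
qed

text \<open>The side conditions separate coinciding points: \<open>(-x1, y1)\<close> is the base
  point when \<open>x1 = 0\<close>. If \<open>y1 = 0\<close> and \<open>x1\<close> is nonzero,
  \<open>(-x1, -y1)\<close> falls under the branch for S, whose formula then also gives the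
  origin.\<close>

lemma f_map_at_base:
  shows "f_map q x1 y1 (Affine x1 y1) = Infinity"
    and "x1 \<noteq> 0 \<or> y1 \<noteq> 0 \<Longrightarrow> f_map q x1 y1 (Affine (- x1) (- y1)) = Point 0 0"
    and "x1 \<noteq> 0 \<Longrightarrow> f_map q x1 y1 (Affine (- x1) y1) =
      Point (y1\<^sup>2 * (x1\<^sup>2 - q)\<^sup>2 / x1\<^sup>2) (q * y1 * (x1\<^sup>2 + y1\<^sup>2) * (x1\<^sup>2 - q)\<^sup>2 / x1 ^ 3)"
    and "x1 \<noteq> 0 \<Longrightarrow> y1 \<noteq> 0 \<Longrightarrow> f_map q x1 y1 (Affine x1 (- y1)) =
      Point (x1\<^sup>2 * (y1\<^sup>2 - q)\<^sup>2 / y1\<^sup>2) (- (q * x1 * (x1\<^sup>2 + y1\<^sup>2) * (y1\<^sup>2 - q)\<^sup>2 / y1 ^ 3))"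
  by (cases "y1 = 0"; simp)+

text \<open>The generic formula fails only for \<open>y^2 = y1^2\<close> or
  \<open>x^2 = y1^2\<close>. The curve equation then makes \<open>(x, y)\<close> one of the points
  with coordinates \<open>x1, y1\<close> up to sign and order, where explicit values are
  compared.\<close>

lemma f_map_rotate:
  assumes nonsing: "q \<noteq> 0" "m \<noteq> 0" "m \<noteq> q\<^sup>2"
    and D1: "(x1, y1) \<in> D_points q m" and D: "(x, y) \<in> D_points q m"
  shows "f_map q x1 y1 (Affine (- y) x) = ec_add q m (f_map q x1 y1 (Affine x y)) (R_point q m)"
proof -
  have m1: "m = (x1\<^sup>2 - q) * (y1\<^sup>2 - q)" and m: "m = (x\<^sup>2 - q) * (y\<^sup>2 - q)"
    using D1 D by (simp_all add: D_points_def)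
  have m1': "m = (y1\<^sup>2 - q) * (x1\<^sup>2 - q)"
    using m1 by (simp add: mult.commute)
  have R: "f_map q x1 y1 (Affine (- y1) x1) = R_point q m"
    "f_map q x1 y1 (Affine y1 (- x1)) = Point m (- 2 * m * q)"
    using f_map_R[OF nonsing(2,3) D1] by (simp_all add: R_point_def)
  have xy1: "y1 \<noteq> 0" if "x1\<^sup>2 = y1\<^sup>2"
    using that m1 nonsing(3) by (auto simp: power2_eq_square)
  have RR: "ec_add q m (Point m (- 2 * m * q)) (R_point q m) = Infinity"
    by (simp add: R_point_def)
  note [simp del] = f_map.simps(1) ec_add.simps(3)
  note rr = ec_add_R_R[OF nonsing]
  note tt = ec_add_two_torsion_R[OF nonsing]
  consider (generic) "x\<^sup>2 \<noteq> y1\<^sup>2" "y\<^sup>2 \<noteq> y1\<^sup>2"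
    | (y) "y\<^sup>2 = y1\<^sup>2" | (x) "x\<^sup>2 = y1\<^sup>2" "y\<^sup>2 \<noteq> y1\<^sup>2"
    by blast
  then show ?thesis
  proof cases
    case generic
    then show ?thesis
      using f_map_rotate_generic[OF nonsing D1 D] by simp
  next
    case y
    then have "x\<^sup>2 = x1\<^sup>2"
      using m m1 nonsing(2) by auto
    then have "x = x1 \<or> x = - x1" "y = y1 \<or> y = - y1"
      using y by (simp_all add: power2_eq_iff)
    \<comment> \<open>The sign choices coincide when \<open>x1\<close> or \<open>y1\<close> is zero;
      the nonvanishing conditions assign such points to an earlier case.\<close>
    then consider "x = x1" "y = y1" | "x = - x1" "y = y1" "x1 \<noteq> 0"
      | "x = - x1" "y = - y1" "y1 \<noteq> 0" | "x = x1" "y = - y1" "x1 \<noteq> 0" "y1 \<noteq> 0"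
      by fastforce
    then show ?thesis
    proof cases
      case 1
      then show ?thesis using R f_map_at_base(1)[of q x1 y1] by simp
    next
      case 2
      \<comment> \<open>If \<open>x1^2 = y1^2\<close>, then S is R or -R and the rotated point is
        exceptional again. Otherwise the rotated point is generic.\<close>
      show ?thesis
      proof (cases "x1\<^sup>2 = y1\<^sup>2")
        case True
        then consider "x1 = y1" | "x1 = - y1"
          by (auto simp: power2_eq_iff)
        then show ?thesis
        proof cases
          case 1
          then have "f_map q x1 y1 (Affine x y) = R_point q m"
            using R(1) 2 by metis
          moreover have "f_map q x1 y1 (Affine (- y) x) = Point 0 0"
            using 1 2 xy1[OF True] f_map_at_base(2)[of x1 y1 q] by simp
          ultimately show ?thesis by (simp only: rr)
        next
          case b: 2
          then have "f_map q x1 y1 (Affine x y) = Point m (- 2 * m * q)"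
            using R(2) 2 by (metis minus_minus)
          moreover have "f_map q x1 y1 (Affine (- y) x) = Infinity"
            using b 2 f_map_at_base(1)[of q x1 y1] by simp
          ultimately show ?thesis by (simp only: RR)
        qed
      next
        case False
        then have "f_map q x1 y1 (Affine x y) = Point (y1\<^sup>2 * (x1\<^sup>2 - q)\<^sup>2 / x1\<^sup>2)
            (q * y1 * (x1\<^sup>2 + y1\<^sup>2) * (x1\<^sup>2 - q)\<^sup>2 / x1 ^ 3)"
          using 2 f_map_at_base(3) by simp
        then show ?thesis
          using ec_add_R_swap(2)[OF nonsing, of x1 "- y1"] m1 2 f_map_swap(2)[OF D1 False] False
          by (simp add: mult.commute)
      qed
    next
      case 3
      then show ?thesis
        using R tt f_map_at_base(2)[of x1 y1 q] by simp
    next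
      case 4
      show ?thesis
      proof (cases "x1\<^sup>2 = y1\<^sup>2")
        case True
        then consider "x1 = y1" | "x1 = - y1"
          by (auto simp: power2_eq_iff)
        then show ?thesis
        proof cases
          case 1
          then have "f_map q x1 y1 (Affine x y) = Point m (- 2 * m * q)"
            using R(2) 4 by metis
          moreover have "f_map q x1 y1 (Affine (- y) x) = Infinity"
            using 1 4 f_map_at_base(1)[of q x1 y1] by simp
          ultimately show ?thesis by (simp only: RR)
        next
          case 2
          then have "f_map q x1 y1 (Affine x y) = R_point q m"
            using R(1) 4 by (metis minus_minus)
          moreover have "f_map q x1 y1 (Affine (- y) x) = Point 0 0"
            using 2 4 xy1[OF True] f_map_at_base(2)[of x1 y1 q] by simp
          ultimately show ?thesis by (simp only: rr)
        qed
      next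
        case False
        \<comment> \<open>\<open>ec_add_R_swap\<close> is used with \<open>a = y1\<close> and
          \<open>b = x1\<close>; the exchange negates the denominator and hence
          \<open>w\<close>.\<close>
        define w where "w = - 2 * (y1\<^sup>2 * (x1\<^sup>2 - q) + x1\<^sup>2 * (y1\<^sup>2 - q)) / ((x1 - y1) * (x1 + y1))"
        have "(y1 - x1) * (y1 + x1) = - ((x1 - y1) * (x1 + y1))"
          by (simp add: algebra_simps)
        then have w: "- 2 * (x1\<^sup>2 * (y1\<^sup>2 - q) + y1\<^sup>2 * (x1\<^sup>2 - q)) / ((y1 - x1) * (y1 + x1)) = - w"
          unfolding w_def by (simp add: add.commute)
        have t: "((y1 + x1) / (y1 - x1))\<^sup>2 = ((x1 + y1) / (x1 - y1))\<^sup>2"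
          by (simp add: power_divide add.commute power2_commute)
        from 4 have "f_map q x1 y1 (Affine x y) = Point (x1\<^sup>2 * (y1\<^sup>2 - q)\<^sup>2 / y1\<^sup>2)
            (- (q * x1 * (x1\<^sup>2 + y1\<^sup>2) * (y1\<^sup>2 - q)\<^sup>2 / y1 ^ 3))"
          using f_map_at_base(4) by simp
        moreover have "f_map q x1 y1 (Affine (- y) x) = f_map q x1 y1 (Affine y1 x1)"
          using 4 by simp
        ultimately show ?thesis
          using ec_add_R_swap(2)[OF nonsing m1' 4(4) False[symmetric]]
          unfolding t w f_map_swap(1)[OF D1 False] w_def[symmetric]
          by (simp only: add.commute mult_minus_right minus_minus)
      qed
    qed
  next
    case x
    then have "y\<^sup>2 = x1\<^sup>2"
      using m m1' nonsing(2) by auto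
    then have ne: "x1\<^sup>2 \<noteq> y1\<^sup>2"
      using x by simp
    from \<open>y\<^sup>2 = x1\<^sup>2\<close> have "x = y1 \<or> x = - y1" "y = x1 \<or> y = - x1"
      using x by (simp_all add: power2_eq_iff)
    then consider "x = y1" "y = - x1" | "x = - y1" "y = x1"
      | "x = y1" "y = x1" "x1 \<noteq> 0" | "x = - y1" "y = - x1" "x1 \<noteq> 0" "y1 \<noteq> 0"
      by fastforce
    then show ?thesis
    proof cases
      case 1
      then show ?thesis using R RR f_map_at_base(1)[of q x1 y1] by simp
    next
      case 2
      then show ?thesis using R rr ne f_map_at_base(2)[of x1 y1 q] by auto
    next
      case 3
      then show ?thesis
        using ec_add_R_swap(1)[OF nonsing m1 3(3) ne] f_map_swap(1)[OF D1 ne] f_map_at_base(3)[of x1 q y1] by simp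
    next
      case 4
      \<comment> \<open>Now \<open>a = y1\<close> and \<open>b = -x1\<close>, so that the sum is the
        value at \<open>(x1, -y1)\<close>.\<close>
      define w where "w = - 2 * (y1\<^sup>2 * (x1\<^sup>2 - q) + x1\<^sup>2 * (y1\<^sup>2 - q)) / ((x1 - y1) * (x1 + y1))"
      have "(y1 - - x1) * (y1 + - x1) = - ((x1 - y1) * (x1 + y1))"
        by (simp add: algebra_simps)
      then have w: "- 2 * ((- x1)\<^sup>2 * (y1\<^sup>2 - q) + y1\<^sup>2 * ((- x1)\<^sup>2 - q)) / ((y1 - - x1) * (y1 + - x1)) = - w"
        unfolding w_def by (simp add: add.commute)
      have "((y1 - x1) / (y1 + x1))\<^sup>2 = ((x1 - y1) / (x1 + y1))\<^sup>2"
        by (simp add: power_divide add.commute power2_commute)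
      then have t: "((y1 + - x1) / (y1 - - x1))\<^sup>2 = ((x1 - y1) / (x1 + y1))\<^sup>2"
        by simp
      have "m = (y1\<^sup>2 - q) * ((- x1)\<^sup>2 - q)" "y1\<^sup>2 \<noteq> (- x1)\<^sup>2"
        using m1' ne by simp_all
      from ec_add_R_swap(1)[OF nonsing this(1) 4(4) this(2)] show ?thesis
        unfolding t w 4(1,2) f_map_swap(2)[OF D1 ne] w_def[symmetric]
        using 4(3,4) f_map_at_base(4)[of x1 y1 q] by (simp add: add.commute)
    qed
  qed
qed

subsection \<open>Reflection and orbits\<close>

text \<open>The line through \<open>S\<close> and \<open>-f(x, y)\<close> has intercept
  \<open>-(y1 (x1\<^sup>2 - q) / x1) u v s t = -m y1 (x1\<^sup>2 - q) (y + y1) / (x1 (y - y1))\<close>; the slope \<open>l\<close> is what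
  remains after cancelling a common factor \<open>y1\<close>, so that \<open>y1 = 0\<close> needs no separate treatment.\<close>

lemma f_map_reflect_generic:
  assumes nonsing: "q \<noteq> 0" "m \<noteq> 0" "m \<noteq> q\<^sup>2"
    and D1: "(x1, y1) \<in> D_points q m" and D: "(x, y) \<in> D_points q m"
    and ne: "y\<^sup>2 \<noteq> y1\<^sup>2" and x1: "x1 \<noteq> 0"
  shows "f_map q x1 y1 (Affine (- x) y) =
    ec_sub q m (S_point q x1 y1) (f_map q x1 y1 (Affine x y))"
proof -
  define u v V p n where "u = y\<^sup>2 - q" and "v = y1\<^sup>2 - q" and "V = x1\<^sup>2 - q"
    and "p = y - y1" and "n = y + y1"
  note defs = u_def v_def V_def p_def n_def
  have H: "(x\<^sup>2 - q) * (y\<^sup>2 - q) = (x1\<^sup>2 - q) * (y1\<^sup>2 - q)" and m: "m = V * v"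
    using D D1 by (simp_all add: D_points_def defs)
  have nz: "p \<noteq> 0" "n \<noteq> 0"
    using ne by (auto simp: add_eq_0_iff defs)
  have nzV: "V \<noteq> 0" "v \<noteq> 0"
    using m nonsing by auto
  define s t k l where "s = (x + x1) / p" and "t = (- x + x1) / p" and "k = y1 * V / x1"
    and "l = (- 2 * q * x1\<^sup>2 + (q + x1\<^sup>2) * y1 * y + (x1\<^sup>2 - q) * y1\<^sup>2) / (x1 * p)"
  define w w' where "w = - 2 * (y1 * x * u + x1 * y * v) / (p * n)"
    and "w' = - 2 * (y1 * - x * u + x1 * y * v) / (p * n)"
  define ws where "ws = q * y1 * (x1\<^sup>2 + y1\<^sup>2) * V\<^sup>2 / x1 ^ 3"
  have s: "s * p = x + x1" and t: "t * p = - x + x1" and k: "k * x1 = y1 * V"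
    and l: "l * (x1 * p) = - 2 * q * x1\<^sup>2 + (q + x1\<^sup>2) * y1 * y + (x1\<^sup>2 - q) * y1\<^sup>2"
    and w: "w * (p * n) = - 2 * (y1 * x * u + x1 * y * v)"
    and w': "w' * (p * n) = - 2 * (y1 * - x * u + x1 * y * v)"
    and ws: "ws * x1\<^sup>2 = k * (q * (x1\<^sup>2 + y1\<^sup>2) * V)"
    using x1 nz
    by (simp_all add: s_def t_def k_def l_def w_def w'_def ws_def power2_eq_square power3_eq_cube)
  let ?L = "- 2 * q * x1\<^sup>2 + (q + x1\<^sup>2) * y1 * y + (x1\<^sup>2 - q) * y1\<^sup>2"
  have f: "f_map q x1 y1 (Affine x y) = Point (u * v * s\<^sup>2) (u * v * s\<^sup>2 * w)"
    "f_map q x1 y1 (Affine (- x) y) = Point (u * v * t\<^sup>2) (u * v * t\<^sup>2 * w')"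
    unfolding f_map_affine_generic[OF D1 D ne] s_def w_def w'_def t_def defs
      f_map_affine_generic[OF D1 D_points_minus_left[OF D] ne]
    by simp_all
  have S: "S_point q x1 y1 = Point (k\<^sup>2) ws"
    using f_map_at_base(3)[OF x1, of q y1]
    by (simp add: S_point_def k_def ws_def V_def power_mult_distrib power_divide del: f_map.simps)
  \<comment> \<open>Subtracting the curve equations gives this form; it yields the second expression
    for the intercept, which is free of \<open>x\<close>.\<close>
  have "u * ((x1 + x) * (x1 - x)) = V * p * n"
    using H unfolding defs by algebra
  then have "(u * v * s * t * p - m * n) * p = 0"
    using s t m by algebra
  then have st: "u * v * s * t * p = m * n"
    using nz by simp
  have "u * v * ((x + x1)\<^sup>2 + (- x + x1)\<^sup>2) * x1\<^sup>2 + y1\<^sup>2 * V\<^sup>2 * p\<^sup>2 =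
      ?L\<^sup>2 - (4 * q\<^sup>2 - 2 * (V * v)) * (x1\<^sup>2 * p\<^sup>2)"
    using H unfolding defs by algebra
  then have "(k\<^sup>2 + u * v * s\<^sup>2 + u * v * t\<^sup>2 - (l\<^sup>2 - (4 * q\<^sup>2 - 2 * m))) * (x1\<^sup>2 * p\<^sup>2) = 0"
    unfolding m s[symmetric] t[symmetric] l[symmetric] using k by algebra
  then have sum: "k\<^sup>2 + u * v * s\<^sup>2 + u * v * t\<^sup>2 = l\<^sup>2 - (4 * q\<^sup>2 - 2 * m)"
    using x1 nz by simp
  \<comment> \<open>This is Vieta's second relation divided by \<open>V^2 * v\<close>, with the
    \<open>x\<close>-free intercept.\<close>
  have "y1\<^sup>2 * u * ((x + x1)\<^sup>2 + (- x + x1)\<^sup>2) + v * n\<^sup>2 * x1\<^sup>2 = v * x1\<^sup>2 * p\<^sup>2 + 2 * ?L * y1 * n"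
    using H unfolding defs by algebra
  then have pair0: "y1\<^sup>2 * u * (s\<^sup>2 + t\<^sup>2) * p\<^sup>2 + v * n\<^sup>2 * x1\<^sup>2 = v * x1\<^sup>2 * p\<^sup>2 + 2 * (l * (x1 * p)) * y1 * n"
    unfolding s[symmetric] t[symmetric] l[symmetric] by algebra
  have "(k\<^sup>2 * u * v * (s\<^sup>2 + t\<^sup>2) * p\<^sup>2 + m\<^sup>2 * n\<^sup>2 - (m\<^sup>2 * p\<^sup>2 + 2 * l * k * m * n * p)) * x1\<^sup>2 = 0"
    using pair0 k unfolding m by algebra
  then have "k\<^sup>2 * u * v * (s\<^sup>2 + t\<^sup>2) * p\<^sup>2 + m\<^sup>2 * n\<^sup>2 = m\<^sup>2 * p\<^sup>2 + 2 * l * k * m * n * p"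
    using x1 by simp
  then have "(k\<^sup>2 * (u * v * s\<^sup>2) + k\<^sup>2 * (u * v * t\<^sup>2) + u * v * s\<^sup>2 * (u * v * t\<^sup>2) -
      (m\<^sup>2 - 2 * l * (- (k * (u * v * s * t))))) * p\<^sup>2 = 0"
    using st by algebra
  then have pair: "k\<^sup>2 * (u * v * s\<^sup>2) + k\<^sup>2 * (u * v * t\<^sup>2) + u * v * s\<^sup>2 * (u * v * t\<^sup>2) =
      m\<^sup>2 - 2 * l * (- (k * (u * v * s * t)))"
    using nz by simp
  have "q * (x1\<^sup>2 + y1\<^sup>2) * p = ?L * y1 - v * n * x1\<^sup>2"
    unfolding defs by algebra
  then have "(ws - (l * k\<^sup>2 + (- (k * (u * v * s * t))))) * (x1\<^sup>2 * p) = 0"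
    unfolding l[symmetric] using ws st k m by algebra
  then have ws': "ws = l * k\<^sup>2 + (- (k * (u * v * s * t)))"
    using x1 nz by simp
  \<comment> \<open>The line equation at -f(x, y) is divided by \<open>u * v * s\<close>. Replacing
    \<open>x\<close> by \<open>-x\<close> exchanges \<open>s\<close> with \<open>t\<close> and
    \<open>w\<close> with \<open>w'\<close>, which gives the equation at the third point.\<close>
  have "2 * (y1 * x * u + x1 * y * v) * (x + x1) * x1 =
      (?L * (x + x1) - y1 * V * (- x + x1) * p) * n"
    using H unfolding defs by algebra
  then have "(- w * s - (l * s - k * t)) * (p\<^sup>2 * n * x1) = 0"
    unfolding l[symmetric] using w s t k by algebra
  then have ws: "- w * s = l * s - k * t"
    using x1 nz by simp
  have "2 * (y1 * - x * u + x1 * y * v) * (- x + x1) * x1 =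
      (?L * (- x + x1) - y1 * V * (x + x1) * p) * n"
    using H unfolding defs by algebra
  then have "(- w' * t - (l * t - k * s)) * (p\<^sup>2 * n * x1) = 0"
    unfolding l[symmetric] using w' s t k by algebra
  then have wt: "- w' * t = l * t - k * s"
    using x1 nz by simp
  show ?thesis
    unfolding f S ec_sub_def ec_neg.simps
  proof (rule ec_add_collinear[OF nonsing sum pair _ ws', symmetric])
    show "k\<^sup>2 * (u * v * s\<^sup>2) * (u * v * t\<^sup>2) = (- (k * (u * v * s * t)))\<^sup>2"
      by algebra
    show "- (u * v * s\<^sup>2 * w) = l * (u * v * s\<^sup>2) + - (k * (u * v * s * t))"
      using ws by algebra
    show "u * v * t\<^sup>2 * w' = - (l * (u * v * t\<^sup>2) + - (k * (u * v * s * t)))"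
      using wt by algebra
  qed
qed

lemma ec_add_Infinity_right: "ec_add q m P Infinity = P"
  by (cases P) auto

text \<open>Outside the generic case the point is \<open>(x1, y1)\<close> up to signs. There the
  claim is settled by the line joining S to the origin.\<close>

lemma f_map_reflect:
  assumes nonsing: "q \<noteq> 0" "m \<noteq> 0" "m \<noteq> q\<^sup>2"
    and D1: "(x1, y1) \<in> D_points q m" and D: "(x, y) \<in> D_points q m"
  shows "f_map q x1 y1 (Affine (- x) y) =
    ec_sub q m (S_point q x1 y1) (f_map q x1 y1 (Affine x y))"
proof (cases "y\<^sup>2 = y1\<^sup>2")
  case False
  show ?thesis
  proof (cases "x1 = 0")
    \<comment> \<open>For \<open>x1 = 0\<close> the abscissa is even and the ordinate odd in
      \<open>x\<close>, so reflection is negation on the curve, in accordance with S being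
      infinity.\<close>
    case True
    then have "S_point q x1 y1 = Infinity"
      by (simp add: S_point_def)
    then show ?thesis
      unfolding f_map_affine_generic[OF D1 D False]
        f_map_affine_generic[OF D1 D_points_minus_left[OF D] False]
      by (simp add: ec_sub_def True power_divide)
  next
    case x1: False
    then show ?thesis
      by (rule f_map_reflect_generic[OF nonsing D1 D False])
  qed
next
  case True
  have m1: "m = (x1\<^sup>2 - q) * (y1\<^sup>2 - q)" and m: "m = (x\<^sup>2 - q) * (y\<^sup>2 - q)"
    using D1 D by (simp_all add: D_points_def)
  have "x\<^sup>2 = x1\<^sup>2"
    using True m m1 nonsing(2) by auto
  then have xy: "x = x1 \<or> x = - x1" "y = y1 \<or> y = - y1"
    using True by (simp_all add: power2_eq_iff)
  define ts ws where "ts = y1\<^sup>2 * (x1\<^sup>2 - q)\<^sup>2 / x1\<^sup>2"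
    and "ws = q * y1 * (x1\<^sup>2 + y1\<^sup>2) * (x1\<^sup>2 - q)\<^sup>2 / x1 ^ 3"
  define t3 w3 where "t3 = x1\<^sup>2 * (y1\<^sup>2 - q)\<^sup>2 / y1\<^sup>2"
    and "w3 = q * x1 * (x1\<^sup>2 + y1\<^sup>2) * (y1\<^sup>2 - q)\<^sup>2 / y1 ^ 3"
  \<comment> \<open>A line through the origin meets the curve again at S and at
    \<open>(t3, w3)\<close>, the negative of f(x1, -y1). It serves both exceptional sums
    below.\<close>
  have line: "ts + t3 = (q * (x1\<^sup>2 + y1\<^sup>2) / (x1 * y1))\<^sup>2 - (4 * q\<^sup>2 - 2 * m)"
      "ts * t3 = m\<^sup>2"
      "ws = q * (x1\<^sup>2 + y1\<^sup>2) / (x1 * y1) * ts"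
      "w3 = q * (x1\<^sup>2 + y1\<^sup>2) / (x1 * y1) * t3"
    if "x1 \<noteq> 0" "y1 \<noteq> 0"
  proof -
    have "y1 ^ 4 * (x1\<^sup>2 - q)\<^sup>2 + x1 ^ 4 * (y1\<^sup>2 - q)\<^sup>2 =
        q\<^sup>2 * (x1\<^sup>2 + y1\<^sup>2)\<^sup>2 - (4 * q\<^sup>2 - 2 * m) * (x1\<^sup>2 * y1\<^sup>2)"
      unfolding m1 by algebra
    moreover have "(ts + t3) * (x1\<^sup>2 * y1\<^sup>2) = y1 ^ 4 * (x1\<^sup>2 - q)\<^sup>2 + x1 ^ 4 * (y1\<^sup>2 - q)\<^sup>2"
      using that by (simp add: ts_def t3_def field_simps power2_eq_square power4_eq_xxxx)
    moreover have "((q * (x1\<^sup>2 + y1\<^sup>2) / (x1 * y1))\<^sup>2 - (4 * q\<^sup>2 - 2 * m)) * (x1\<^sup>2 * y1\<^sup>2) =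
        q\<^sup>2 * (x1\<^sup>2 + y1\<^sup>2)\<^sup>2 - (4 * q\<^sup>2 - 2 * m) * (x1\<^sup>2 * y1\<^sup>2)"
      using that by (simp add: left_diff_distrib power_divide power_mult_distrib)
    moreover have "x1\<^sup>2 * y1\<^sup>2 \<noteq> 0"
      using that by simp
    ultimately show "ts + t3 = (q * (x1\<^sup>2 + y1\<^sup>2) / (x1 * y1))\<^sup>2 - (4 * q\<^sup>2 - 2 * m)"
      by (metis mult_right_cancel)
    show "ts * t3 = m\<^sup>2"
      using that by (simp add: ts_def t3_def m1 power_mult_distrib)
    show "ws = q * (x1\<^sup>2 + y1\<^sup>2) / (x1 * y1) * ts" "w3 = q * (x1\<^sup>2 + y1\<^sup>2) / (x1 * y1) * t3"
      using that by (simp_all add: ts_def t3_def ws_def w3_def power2_eq_square power3_eq_cube mult_ac)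
  qed
  have S: "S_point q x1 y1 = Point ts ws" if "x1 \<noteq> 0"
    using f_map_at_base(3)[OF that] by (simp only: S_point_def ts_def ws_def)
  have f: "x1 \<noteq> 0 \<Longrightarrow> f_map q x1 y1 (Affine (- x1) y1) = Point ts ws"
    "x1 \<noteq> 0 \<Longrightarrow> y1 \<noteq> 0 \<Longrightarrow> f_map q x1 y1 (Affine x1 (- y1)) = Point t3 (- w3)"
    using f_map_at_base(3,4) by (simp_all only: ts_def ws_def t3_def w3_def)
  note [simp del] = f_map.simps(1) ec_add.simps(3)
  from xy consider "x = x1" "y = y1" | "x = - x1" "y = y1" "x1 \<noteq> 0"
    | "x = - x1" "y = - y1" "y1 \<noteq> 0" | "x = x1" "y = - y1" "x1 \<noteq> 0" "y1 \<noteq> 0"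
    by fastforce
  then show ?thesis
  proof cases
    case 1
    then show ?thesis
      using f_map_at_base(1)[of q x1 y1]
      by (simp add: S_point_def ec_sub_def ec_add_Infinity_right)
  next
    case 2
    then show ?thesis
      using f_map_at_base(1)[of q x1 y1] f(1) S
      by (simp add: ec_sub_def ec_add.simps(3))
  next
    case 3
    have "f_map q x1 y1 (Affine x1 (- y1)) = ec_add q m (S_point q x1 y1) (Point 0 0)"
    proof (cases "x1 = 0")
      case True
      then show ?thesis
        using 3 by (simp add: S_point_def f_map.simps(1))
    next
      case False
      have "ec_add q m (Point ts ws) (Point 0 0) = Point t3 (- w3)"
        by (rule ec_add_collinear[OF nonsing, where l = "q * (x1\<^sup>2 + y1\<^sup>2) / (x1 * y1)" and c = 0])
          (use line[OF False 3(3)] in auto)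
      then show ?thesis
        using f(2)[OF False 3(3)] S[OF False] by simp
    qed
    then show ?thesis
      using 3 f_map_at_base(2)[of x1 y1 q] by (simp add: ec_sub_def)
  next
    case 4
    have "ec_add q m (Point ts ws) (Point t3 w3) = Point 0 0"
      by (rule ec_add_collinear[OF nonsing, where l = "q * (x1\<^sup>2 + y1\<^sup>2) / (x1 * y1)" and c = 0])
        (use line[OF 4(3,4)] in auto)
    then show ?thesis
      using f_map_at_base(2)[of x1 y1 q] f(2) S 4 by (simp add: ec_sub_def)
  qed
qed

section \<open>Orbits of G\<close>

lemma G_orbitI: "h \<in> G_maps q m x1 y1 \<Longrightarrow> h P \<in> G_orbit q m x1 y1 P"
  by (auto simp: G_orbit_def)

lemma G_orbit_self: "P \<in> G_orbit q m x1 y1 P"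
  using G_orbitI[OF G_maps.intros(1)] by simp

lemma G_orbit_reflect:
  assumes "P \<in> G_orbit q m x1 y1 Q"
  shows "ec_sub q m (S_point q x1 y1) P \<in> G_orbit q m x1 y1 Q"
proof -
  obtain h where h: "P = h Q" "h \<in> G_maps q m x1 y1"
    using assms by (auto simp: G_orbit_def)
  have "(\<lambda>P. ec_sub q m (S_point q x1 y1) (h P)) \<in> G_maps q m x1 y1"
    using h(2) by (rule G_maps.intros(2))
  from G_orbitI[OF this, of Q] show ?thesis
    by (simp add: h(1))
qed

lemma G_orbit_add_R:
  assumes "P \<in> G_orbit q m x1 y1 Q"
  shows "ec_add q m P (R_point q m) \<in> G_orbit q m x1 y1 Q"
proof -
  obtain h where h: "P = h Q" "h \<in> G_maps q m x1 y1"
    using assms by (auto simp: G_orbit_def)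
  have "(\<lambda>P. ec_add q m (h P) (R_point q m)) \<in> G_maps q m x1 y1"
    using h(2) by (rule G_maps.intros(3))
  from G_orbitI[OF this, of Q] show ?thesis
    by (simp add: h(1))
qed

text \<open>Reflection and rotation generate all eight points obtained from \<open>(x, y)\<close> by
  signs and exchange.\<close>

lemma f_map_in_G_orbit:
  assumes nonsing: "q \<noteq> 0" "m \<noteq> 0" "m \<noteq> q\<^sup>2"
    and D1: "(x1, y1) \<in> D_points q m"
    and D: "(x, y) \<in> D_points q m" and D': "(x', y') \<in> D_points q m"
    and eq: "x'\<^sup>2 = x\<^sup>2 \<or> x'\<^sup>2 = y\<^sup>2"
  shows "f_map q x1 y1 (Affine x' y') \<in> G_orbit q m x1 y1 (f_map q x1 y1 (Affine x y))"
proof -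
  let ?O = "G_orbit q m x1 y1 (f_map q x1 y1 (Affine x y))"
  have base: "f_map q x1 y1 (Affine x y) \<in> ?O"
    by (rule G_orbit_self)
  have ref: "f_map q x1 y1 (Affine (- r) s) \<in> ?O"
    if "f_map q x1 y1 (Affine r s) \<in> ?O" "(r, s) \<in> D_points q m" for r s
    using that(1) unfolding f_map_reflect[OF nonsing D1 that(2)] by (rule G_orbit_reflect)
  have rot: "f_map q x1 y1 (Affine (- s) r) \<in> ?O"
    if "f_map q x1 y1 (Affine r s) \<in> ?O" "(r, s) \<in> D_points q m" for r s
    using that(1) unfolding f_map_rotate[OF nonsing D1 that(2)] by (rule G_orbit_add_R)
  note minus = D_points_minus_left D_points_minus_right
  have 1: "f_map q x1 y1 (Affine (- x) y) \<in> ?O"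
    by (rule ref[OF base D])
  have 2: "f_map q x1 y1 (Affine (- y) x) \<in> ?O"
    by (rule rot[OF base D])
  have 3: "f_map q x1 y1 (Affine y x) \<in> ?O"
    using ref[OF 2 minus(1)[OF D_points_swap[OF D]]] by (simp only: minus_minus)
  have 4: "f_map q x1 y1 (Affine (- y) (- x)) \<in> ?O"
    by (rule rot[OF 1 minus(1)[OF D]])
  have 5: "f_map q x1 y1 (Affine y (- x)) \<in> ?O"
    using ref[OF 4 minus(1)[OF minus(2)[OF D_points_swap[OF D]]]] by (simp only: minus_minus)
  have 6: "f_map q x1 y1 (Affine (- x) (- y)) \<in> ?O"
    by (rule rot[OF 2 minus(1)[OF D_points_swap[OF D]]])
  have 7: "f_map q x1 y1 (Affine x (- y)) \<in> ?O"
    using ref[OF 6 minus(1)[OF minus(2)[OF D]]] by (simp only: minus_minus)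
  have m: "(x\<^sup>2 - q) * (y\<^sup>2 - q) = m" "(x'\<^sup>2 - q) * (y'\<^sup>2 - q) = m"
    using D D' by (simp_all add: D_points_def)
  \<comment> \<open>As \<open>m\<close> is nonzero, the curve equation determines
    \<open>y'^2\<close> from \<open>x'^2\<close>.\<close>
  from eq have "x'\<^sup>2 = x\<^sup>2 \<and> y'\<^sup>2 = y\<^sup>2 \<or> x'\<^sup>2 = y\<^sup>2 \<and> y'\<^sup>2 = x\<^sup>2"
    using m nonsing(2) by (auto simp: mult.commute)
  then show ?thesis
    unfolding power2_eq_iff using base 1 2 3 4 5 6 7 by (elim disjE conjE) (simp_all only:)
qed

subsection \<open>Square classes\<close>

text \<open>Modulo squares this is the 2-descent homomorphism attached to the 2-torsion point \<open>(0, 0)\<close>,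
  whose value at \<open>(0, 0)\<close> itself is the coefficient \<open>m\<^sup>2\<close>, i.e. the trivial class.\<close>

fun descent :: "ec_point \<Rightarrow> rat" where
  "descent Infinity = 1"
| "descent (Point T W) = (if T = 0 then 1 else T)"

lemma descent_nonzero: "descent P \<noteq> 0"
  by (cases P) auto

text \<open>A converse to \<open>ec_add_collinear\<close>: Vieta's relations are recovered from
  membership in the curve.\<close>

lemma ec_add_line:
  assumes "Point t1 w1 \<in> E_points q m" "Point t2 w2 \<in> E_points q m"
    and "\<not> (t1 = t2 \<and> w1 = - w2)"
  obtains l c t3 where "ec_add q m (Point t1 w1) (Point t2 w2) = Point t3 (- (l * t3 + c))"
    and "t1 + t2 + t3 = l\<^sup>2 - (4 * q\<^sup>2 - 2 * m)"
    and "t1 * t2 + t1 * t3 + t2 * t3 = m\<^sup>2 - 2 * l * c"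
    and "t1 * t2 * t3 = c\<^sup>2"
proof -
  have E: "w1\<^sup>2 = t1 ^ 3 + (4 * q\<^sup>2 - 2 * m) * t1\<^sup>2 + m\<^sup>2 * t1"
    "w2\<^sup>2 = t2 ^ 3 + (4 * q\<^sup>2 - 2 * m) * t2\<^sup>2 + m\<^sup>2 * t2"
    using assms by (simp_all add: E_points_def)
  define l where "l = (if t1 = t2
    then (3 * t1\<^sup>2 + 2 * (4 * q\<^sup>2 - 2 * m) * t1 + m\<^sup>2) / (2 * w1) else (w2 - w1) / (t2 - t1))"
  define c where "c = w1 - l * t1"
  define t3 where "t3 = l\<^sup>2 - (4 * q\<^sup>2 - 2 * m) - t1 - t2"
  have sum: "t1 + t2 + t3 = l\<^sup>2 - (4 * q\<^sup>2 - 2 * m)"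
    by (simp add: t3_def)
  have w1: "w1 = l * t1 + c"
    by (simp add: c_def)
  have pair: "t1 * t2 + t1 * t3 + t2 * t3 = m\<^sup>2 - 2 * l * c"
  proof (cases "t1 = t2")
    case True
    then have "w1\<^sup>2 = w2\<^sup>2"
      using E by simp
    then have "w1 = w2" "w1 \<noteq> 0"
      using assms(3) True by (auto simp: power2_eq_iff)
    then have "l * (2 * w1) = 3 * t1\<^sup>2 + 2 * (4 * q\<^sup>2 - 2 * m) * t1 + m\<^sup>2"
      using True by (simp add: l_def)
    with sum w1 True show ?thesis by algebra
  next
    case False
    then have "l * (t2 - t1) = w2 - w1"
      by (simp add: l_def)
    then have w2: "w2 = l * t2 + c"
      by (simp add: w1 algebra_simps)
    \<comment> \<open>The difference of the two curve equations is divisible by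
      \<open>t2 - t1\<close>.\<close>
    have "(t1 * t2 + t1 * t3 + t2 * t3 - (m\<^sup>2 - 2 * l * c)) * (t2 - t1) = 0"
      using E sum unfolding w1 w2 by algebra
    with False show ?thesis by simp
  qed
  have prod: "t1 * t2 * t3 = c\<^sup>2"
    using E(1) sum pair unfolding w1 by algebra
  have "ec_add q m (Point t1 w1) (Point t2 w2) = Point t3 (l * (t1 - t3) - w1)"
    by (simp only: ec_add.simps Let_def if_not_P[OF assms(3)] l_def[symmetric] t3_def[symmetric])
  moreover have "l * (t1 - t3) - w1 = - (l * t3 + c)"
    by (simp add: c_def algebra_simps)
  ultimately show thesis
    using that sum pair prod by metis
qed

lemma ec_add_closed:
  assumes "P \<in> E_points q m" "Q \<in> E_points q m"
  shows "ec_add q m P Q \<in> E_points q m"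
proof (cases P; cases Q)
  fix t1 w1 t2 w2 assume PQ: "P = Point t1 w1" "Q = Point t2 w2"
  show ?thesis
  proof (cases "t1 = t2 \<and> w1 = - w2")
    case True
    then show ?thesis by (simp add: PQ E_points_def)
  next
    case False
    obtain l c t3 where *: "ec_add q m P Q = Point t3 (- (l * t3 + c))"
      "t1 + t2 + t3 = l\<^sup>2 - (4 * q\<^sup>2 - 2 * m)"
      "t1 * t2 + t1 * t3 + t2 * t3 = m\<^sup>2 - 2 * l * c" "t1 * t2 * t3 = c\<^sup>2"
      using ec_add_line[OF assms[unfolded PQ] False] PQ by metis
    have "(- (l * t3 + c))\<^sup>2 = t3 ^ 3 + (4 * q\<^sup>2 - 2 * m) * t3\<^sup>2 + m\<^sup>2 * t3"
      using *(2-4) by algebra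
    then show ?thesis by (simp add: * E_points_def)
  qed
qed (use assms in \<open>auto simp: E_points_def\<close>)

text \<open>Square classes are their own inverses, so this is multiplicativity; it comes from
  \<open>t1 t2 t3 = c^2\<close>.\<close>

lemma descent_ec_add:
  assumes "m \<noteq> 0" "P \<in> E_points q m" "Q \<in> E_points q m"
  shows "is_square (descent P * descent Q * descent (ec_add q m P Q))"
proof (cases P; cases Q)
  fix t1 w1 t2 w2 assume PQ: "P = Point t1 w1" "Q = Point t2 w2"
  show ?thesis
  proof (cases "t1 = t2 \<and> w1 = - w2")
    case True
    then show ?thesis by (simp add: PQ power2_eq_square[symmetric])
  next
    case False
    obtain l c t3 where *: "ec_add q m (Point t1 w1) (Point t2 w2) = Point t3 (- (l * t3 + c))"
      "t1 * t2 + t1 * t3 + t2 * t3 = m\<^sup>2 - 2 * l * c" "t1 * t2 * t3 = c\<^sup>2"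
      using ec_add_line[OF assms(2,3)[unfolded PQ] False] by metis
    show ?thesis
    proof (cases "t1 * t2 * t3 = 0")
      case True
      \<comment> \<open>A vanishing abscissa forces \<open>c = 0\<close>. The pair relation then
        leaves \<open>m^2\<close> as product of the other two, which matches the value 1 at the
        origin.\<close>
      then have "t1 * t2 + t1 * t3 + t2 * t3 = m\<^sup>2"
        using *(2,3) by simp
      with True \<open>m \<noteq> 0\<close> have "descent P * descent Q * descent (ec_add q m P Q) = m\<^sup>2"
        unfolding PQ *(1) by (auto simp: power2_eq_square)
      then show ?thesis by simp
    next
      case False
      then have "descent P * descent Q * descent (ec_add q m P Q) = c\<^sup>2"
        unfolding PQ *(1) using False *(3) by auto
      then show ?thesis by simp
    qed
  qed
qed (auto simp: power2_eq_square[symmetric])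

lemma is_square_mult_cancel:
  fixes a b :: "'a :: field"
  assumes "is_square a" "a \<noteq> 0"
  shows "is_square (a * b) \<longleftrightarrow> is_square b"
proof
  assume "is_square (a * b)"
  then obtain r s where "a = r\<^sup>2" "a * b = s\<^sup>2"
    using assms by (auto simp: is_nth_power_def)
  then have "b = (s / r)\<^sup>2"
    using assms(2) by (simp add: power_divide nonzero_eq_divide_eq mult.commute)
  then show "is_square b" by simp
qed (use assms in \<open>auto intro: is_nth_power_mult\<close>)

text \<open>Multiplied by \<open>(x1^2 - q) (x^2 - q)\<close>, the factored abscissa becomes
  \<open>m^2\<close> times a square. At exceptional points \<open>x^2 = x1^2\<close> and the
  abscissae are squares.\<close>

lemma descent_f_map:
  assumes "m \<noteq> 0" and D1: "(x1, y1) \<in> D_points q m" and D: "(x, y) \<in> D_points q m"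
  shows "is_square (descent (f_map q x1 y1 (Affine x y)) * ((x1\<^sup>2 - q) * (x\<^sup>2 - q)))"
proof (cases "y\<^sup>2 = y1\<^sup>2")
  case True
  have m1: "(x1\<^sup>2 - q) * (y1\<^sup>2 - q) = m" and m: "(x\<^sup>2 - q) * (y\<^sup>2 - q) = m"
    using D1 D by (simp_all add: D_points_def)
  then have x: "x\<^sup>2 = x1\<^sup>2"
    using True assms(1) by auto
  let ?T = "y1\<^sup>2 * (x1\<^sup>2 - q)\<^sup>2 / x1\<^sup>2" and ?T' = "x1\<^sup>2 * (y1\<^sup>2 - q)\<^sup>2 / y1\<^sup>2"
  have "is_square (descent (f_map q x1 y1 (Affine x y)))"
  proof -
    have "?T = (y1 * (x1\<^sup>2 - q) / x1)\<^sup>2" "?T' = (x1 * (y1\<^sup>2 - q) / y1)\<^sup>2"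
      by (simp_all add: power_mult_distrib power_divide)
    then have "is_square ?T" "is_square ?T'"
      by (simp_all only: is_nth_power_nth_power)
    moreover have "is_square (descent (Point T W))" if "is_square T" for T W
      using that by simp
    ultimately show ?thesis
      using True by (simp del: descent.simps(2))
  qed
  then show ?thesis
    unfolding x by (simp add: is_nth_power_mult power2_eq_square[symmetric] del: f_map.simps)
next
  case False
  have m1: "(x1\<^sup>2 - q) * (y1\<^sup>2 - q) = m" and m: "(x\<^sup>2 - q) * (y\<^sup>2 - q) = m"
    using D1 D by (simp_all add: D_points_def)
  have "(y1\<^sup>2 - q) * (x1\<^sup>2 - x\<^sup>2) = (x\<^sup>2 - q) * (y\<^sup>2 - y1\<^sup>2)"
  proof -
    have "(x\<^sup>2 - q) * (y\<^sup>2 - q) = (x1\<^sup>2 - q) * (y1\<^sup>2 - q)"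
      using m1 m by simp
    then show ?thesis by algebra
  qed
  \<comment> \<open>This keeps the abscissa nonzero, so \<open>descent\<close> does not take its
    default value 1.\<close>
  then have "x + x1 \<noteq> 0"
    using False m assms(1) by (auto simp: add_eq_0_iff)
  moreover have "y - y1 \<noteq> 0"
    using False by auto
  moreover have "y\<^sup>2 - q \<noteq> 0" "y1\<^sup>2 - q \<noteq> 0"
    using m m1 assms(1) by auto
  ultimately have "descent (f_map q x1 y1 (Affine x y)) =
      (y\<^sup>2 - q) * (y1\<^sup>2 - q) * ((x + x1) / (y - y1))\<^sup>2"
    unfolding f_map_affine_generic[OF D1 D False] by simp
  then have "descent (f_map q x1 y1 (Affine x y)) * ((x1\<^sup>2 - q) * (x\<^sup>2 - q)) =
      ((x\<^sup>2 - q) * (y\<^sup>2 - q)) * ((x1\<^sup>2 - q) * (y1\<^sup>2 - q)) * ((x + x1) / (y - y1))\<^sup>2"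
    by simp
  also have "\<dots> = (m * ((x + x1) / (y - y1)))\<^sup>2"
    unfolding m1 m by (simp add: power2_eq_square)
  finally show ?thesis by simp
qed

text \<open>A pole of \<open>x\<close> gives \<open>None\<close>, so the chosen preimage is affine
  or of the form \<open>Y_inf e\<close>.\<close>

lemma g_mapE:
  assumes "g_map q m x1 y1 P = Some g"
  obtains (affine) x y where "(x, y) \<in> D_points q m" "P = f_map q x1 y1 (Affine x y)"
      "g = (x1\<^sup>2 - q) * (x\<^sup>2 - q)"
    | (infinite) e where "e\<^sup>2 = q" "P = f_map q x1 y1 (Y_inf e)" "g = 0"
proof -
  define p where "p = inv_into (D_places q m) (f_map q x1 y1) P"
  have P: "P \<in> f_map q x1 y1 ` D_places q m"
    and x: "map_option (\<lambda>x. (x1\<^sup>2 - q) * (x\<^sup>2 - q)) (x_coord p) = Some g"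
    using assms by (auto simp: g_map_def x_f_inv_def p_def split: if_splits)
  have "p \<in> D_places q m" "P = f_map q x1 y1 p"
    using inv_into_into[OF P] f_inv_into_f[OF P] by (simp_all add: p_def)
  then show thesis
    using x that by (cases p) (auto simp: D_places_def simp del: f_map.simps)
qed

text \<open>At a place \<open>Y_inf e\<close> the function \<open>g\<close> vanishes; there the equivalence holds because
  \<open>T = (y1\<^sup>2 - q) (x1 + e)\<^sup>2\<close> makes both sides true.\<close>

lemma g_map_descent:
  assumes "m \<noteq> 0" and D1: "(x1, y1) \<in> D_points q m" and g: "g_map q m x1 y1 P = Some g"
  shows "is_square ((y1\<^sup>2 - q) * g) \<longleftrightarrow> is_square ((y1\<^sup>2 - q) * descent P)"
  using g
proof (cases rule: g_mapE)
  case (affine x y)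
  have "(x1\<^sup>2 - q) * (y1\<^sup>2 - q) = m" "(x\<^sup>2 - q) * (y\<^sup>2 - q) = m"
    using D1 affine(1) by (simp_all add: D_points_def)
  then have g0: "g \<noteq> 0"
    using affine(3) assms(1) by auto
  have s: "is_square (descent P * g)"
    using descent_f_map[OF assms(1) D1 affine(1)] affine by simp
  have "is_square ((y1\<^sup>2 - q) * g) \<longleftrightarrow> is_square ((descent P)\<^sup>2 * ((y1\<^sup>2 - q) * g))"
    by (rule is_square_mult_cancel[symmetric]) (simp_all add: descent_nonzero)
  also have "(descent P)\<^sup>2 * ((y1\<^sup>2 - q) * g) = (descent P * g) * ((y1\<^sup>2 - q) * descent P)"
    by (simp add: power2_eq_square)
  also have "is_square \<dots> \<longleftrightarrow> is_square ((y1\<^sup>2 - q) * descent P)"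
    by (rule is_square_mult_cancel[OF s]) (simp add: descent_nonzero g0)
  finally show ?thesis .
next
  case (infinite e)
  have "(x1\<^sup>2 - q) * (y1\<^sup>2 - q) = m"
    using D1 by (simp add: D_points_def)
  then have "x1\<^sup>2 \<noteq> e\<^sup>2" "y1\<^sup>2 - q \<noteq> 0"
    using infinite(1) assms(1) by auto
  then have "descent P = (y1\<^sup>2 - q) * (x1 + e)\<^sup>2"
    by (auto simp: infinite(2) Let_def add_eq_0_iff)
  then have "(y1\<^sup>2 - q) * descent P = ((y1\<^sup>2 - q) * (x1 + e))\<^sup>2"
    by (simp add: power2_eq_square)
  then have "is_square ((y1\<^sup>2 - q) * descent P)"
    by (simp only: is_nth_power_nth_power)
  then show ?thesis
    by (simp add: infinite(3))
qed

text \<open>The numbers \<open>g1, g2, g3\<close> enter through their square classes only. Thus one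
  equivalence serves values of \<open>g_map\<close> as well as values computed from the products of
  a given quadruple.\<close>

lemma is_square_g_map_sum:
  assumes "m \<noteq> 0" and D1: "(x1, y1) \<in> D_points q m"
    and Q: "Q1 \<in> E_points q m" "Q2 \<in> E_points q m" "Q3 \<in> E_points q m"
    and g: "is_square (descent Q1 * g1)" "is_square (descent Q2 * g2)" "is_square (descent Q3 * g3)"
    and g0: "g1 \<noteq> 0" "g2 \<noteq> 0" "g3 \<noteq> 0"
    and g123: "g_map q m x1 y1 (ec_add q m (ec_add q m Q1 Q2) Q3) = Some g123"
  shows "is_square ((y1\<^sup>2 - q) * g123) \<longleftrightarrow> is_square ((y1\<^sup>2 - q) * (g1 * g2 * g3))"
proof -
  let ?v = "y1\<^sup>2 - q" and ?Q12 = "ec_add q m Q1 Q2"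
  let ?Q = "ec_add q m ?Q12 Q3"
  \<comment> \<open>In this product of five squares the classes of the points cancel in pairs
    against \<open>descent ?Q\<close>, leaving \<open>g1 g2 g3\<close>.\<close>
  let ?s = "(descent Q1 * g1) * (descent Q2 * g2) * (descent Q3 * g3) *
    (descent Q1 * descent Q2 * descent ?Q12) * (descent ?Q12 * descent Q3 * descent ?Q)"
  let ?t = "descent Q1 * descent Q2 * descent Q3 * descent ?Q12 * descent ?Q"
  have s: "is_square ?s"
    by (intro is_nth_power_mult g descent_ec_add[OF assms(1)] ec_add_closed Q)
  have "is_square (?v * g123) \<longleftrightarrow> is_square (?v * descent ?Q)"
    by (rule g_map_descent[OF assms(1) D1 g123])
  also have "\<dots> \<longleftrightarrow> is_square (?s * (?v * descent ?Q))"
    by (rule is_square_mult_cancel[OF s, symmetric]) (simp add: descent_nonzero g0)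
  also have "?s * (?v * descent ?Q) = ?t\<^sup>2 * (?v * (g1 * g2 * g3))"
    by algebra
  also have "is_square \<dots> \<longleftrightarrow> is_square (?v * (g1 * g2 * g3))"
    by (rule is_square_mult_cancel) (simp_all add: descent_nonzero)
  finally show ?thesis .
qed

lemma is_Dq_quadrupleI:
  assumes "distinct [a, b, c, d]" "0 \<notin> {a, b, c, d}"
    and "is_square (a * b + q)" "is_square (a * c + q)" "is_square (a * d + q)"
    and "is_square (b * c + q)" "is_square (b * d + q)" "is_square (c * d + q)"
  shows "is_Dq_quadruple q a b c d"
  using assms by (auto simp: is_Dq_quadruple_def mult.commute)

subsection \<open>Quadruples\<close>

text \<open>Here \<open>(x1, y1)\<close> is the first of three points, not the base point of f. From
  \<open>abcd = m\<close> the complementary products are \<open>y_i^2 - q\<close>.\<close>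

lemma is_Dq_quadruple_of_D_points:
  assumes "m \<noteq> 0"
    and D: "(x1, y1) \<in> D_points q m" "(x2, y2) \<in> D_points q m" "(x3, y3) \<in> D_points q m"
    and ne: "x1\<^sup>2 \<noteq> x2\<^sup>2" "x1\<^sup>2 \<noteq> x3\<^sup>2" "x2\<^sup>2 \<noteq> x3\<^sup>2"
      "x1\<^sup>2 \<noteq> y2\<^sup>2" "x1\<^sup>2 \<noteq> y3\<^sup>2" "x2\<^sup>2 \<noteq> y3\<^sup>2"
    and a: "m * a\<^sup>2 = (x1\<^sup>2 - q) * (x2\<^sup>2 - q) * (x3\<^sup>2 - q)"
  defines "b \<equiv> (x1\<^sup>2 - q) / a" and "c \<equiv> (x2\<^sup>2 - q) / a" and "d \<equiv> (x3\<^sup>2 - q) / a"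
  shows "is_Dq_quadruple q a b c d" "a * b * c * d = m"
proof -
  have m: "(x1\<^sup>2 - q) * (y1\<^sup>2 - q) = m" "(x2\<^sup>2 - q) * (y2\<^sup>2 - q) = m" "(x3\<^sup>2 - q) * (y3\<^sup>2 - q) = m"
    using D by (simp_all add: D_points_def)
  then have nz: "x1\<^sup>2 - q \<noteq> 0" "x2\<^sup>2 - q \<noteq> 0" "x3\<^sup>2 - q \<noteq> 0"
    using \<open>m \<noteq> 0\<close> by auto
  then have "a \<noteq> 0"
    using a by auto
  then have ab: "a * b = x1\<^sup>2 - q" and ac: "a * c = x2\<^sup>2 - q" and ad: "a * d = x3\<^sup>2 - q"
    by (simp_all add: b_def c_def d_def)
  have prod: "a\<^sup>2 * (a * b * c * d) = a\<^sup>2 * m"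
    using a unfolding ab[symmetric] ac[symmetric] ad[symmetric] by algebra
  then show abcd: "a * b * c * d = m"
    using \<open>a \<noteq> 0\<close> by simp
  have cd: "c * d = y1\<^sup>2 - q" and bd: "b * d = y2\<^sup>2 - q" and bc: "b * c = y3\<^sup>2 - q"
  proof -
    have "(a * b) * (c * d) = (a * b) * (y1\<^sup>2 - q)" "(a * c) * (b * d) = (a * c) * (y2\<^sup>2 - q)"
      "(a * d) * (b * c) = (a * d) * (y3\<^sup>2 - q)"
      using abcd m unfolding ab ac ad by (simp_all add: mult_ac ab[symmetric] ac[symmetric] ad[symmetric])
    then show "c * d = y1\<^sup>2 - q" "b * d = y2\<^sup>2 - q" "b * c = y3\<^sup>2 - q"
      using nz unfolding ab ac ad by simp_all
  qed
  \<comment> \<open>Each equality of two entries, multiplied by a third, equates two of the squares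
    separated by \<open>ne\<close>.\<close>
  have "a \<noteq> b" using ac bc ne(6) by auto
  moreover have "a \<noteq> c" using ab bc ne(5) by (auto simp: mult.commute)
  moreover have "a \<noteq> d" using ab bd ne(4) by (auto simp: mult.commute)
  moreover have "b \<noteq> c" using ab ac ne(1) by auto
  moreover have "b \<noteq> d" using ab ad ne(2) by auto
  moreover have "c \<noteq> d" using ac ad ne(3) by auto
  moreover have "b \<noteq> 0" "c \<noteq> 0" "d \<noteq> 0"
    using nz \<open>a \<noteq> 0\<close> by (simp_all add: b_def c_def d_def)
  ultimately show "is_Dq_quadruple q a b c d"
    using \<open>a \<noteq> 0\<close> by (intro is_Dq_quadrupleI) (simp_all add: ab ac ad cd bd bc)
qed

lemma g_map_affineE:
  assumes "m \<noteq> 0" "(x1, y1) \<in> D_points q m" "g_map q m x1 y1 P = Some g" "g \<noteq> 0"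
  obtains x y where "(x, y) \<in> D_points q m" "P = f_map q x1 y1 (Affine x y)"
    "g / (x1\<^sup>2 - q) = x\<^sup>2 - q"
  using assms(3)
proof (cases rule: g_mapE)
  case (affine x y)
  moreover have "x1\<^sup>2 - q \<noteq> 0"
    using assms(1,2) by (auto simp: D_points_def)
  ultimately show ?thesis using that by simp
qed (use assms(4) in auto)

lemma descent_g_map:
  assumes "m \<noteq> 0" "(x1, y1) \<in> D_points q m" "g_map q m x1 y1 P = Some g" "g \<noteq> 0"
  shows "is_square (descent P * g)"
  using assms(3)
proof (cases rule: g_mapE)
  case (affine x y)
  then show ?thesis using descent_f_map[OF assms(1,2)] by simp
qed (use assms(4) in auto)

lemma nondegenerate_D_points:
  assumes nonsing: "q \<noteq> 0" "m \<noteq> 0" "m \<noteq> q\<^sup>2" and D1: "(x1, y1) \<in> D_points q m"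
    and D: "(x, y) \<in> D_points q m" "(x', y') \<in> D_points q m"
    and disj: "G_orbit q m x1 y1 (f_map q x1 y1 (Affine x y)) \<inter>
      G_orbit q m x1 y1 (f_map q x1 y1 (Affine x' y')) = {}"
  shows "x\<^sup>2 \<noteq> x'\<^sup>2" "x\<^sup>2 \<noteq> y'\<^sup>2"
  using f_map_in_G_orbit[OF nonsing D1 D(2) D(1)] G_orbit_self disj by blast+

section \<open>Rationality of the root and the two directions of the theorem\<close>

lemma csqrt_of_rat_square:
  "csqrt (of_rat (s\<^sup>2)) = of_rat s \<or> csqrt (of_rat (s\<^sup>2)) = - of_rat s"
proof -
  have "(csqrt (of_rat (s\<^sup>2)))\<^sup>2 = (of_rat s)\<^sup>2"
    by (simp only: power2_csqrt of_rat_power)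
  then show ?thesis by (simp only: power2_eq_iff)
qed

theorem theorem1:
  fixes q m x1 y1 :: rat
  assumes "q \<noteq> 0" and "m \<noteq> 0" and "m \<noteq> q\<^sup>2"
    and "(x1, y1) \<in> D_points q m"
  shows
    "(\<forall>Q1\<in>E_points q m. \<forall>Q2\<in>E_points q m. \<forall>Q3\<in>E_points q m. \<forall>g1 g2 g3 g123 :: rat.
        nondegenerate q m x1 y1 Q1 Q2 Q3 \<and>
        g_map q m x1 y1 Q1 = Some g1 \<and> g1 \<noteq> 0 \<and>
        g_map q m x1 y1 Q2 = Some g2 \<and> g2 \<noteq> 0 \<and>
        g_map q m x1 y1 Q3 = Some g3 \<and> g3 \<noteq> 0 \<and>
        g_map q m x1 y1 (ec_add q m (ec_add q m Q1 Q2) Q3) = Some g123 \<and>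
        is_square ((y1\<^sup>2 - q) * g123)
        \<longrightarrow>
        (let r = x1\<^sup>2 - q;
             z = csqrt (of_rat (1 / m * (g1 / r) * (g2 / r) * (g3 / r)))
         in \<forall>a b c d :: complex.
              (a = z \<or> a = - z) \<and>
              b = of_rat g1 / (a * of_rat r) \<and>
              c = of_rat g2 / (a * of_rat r) \<and>
              d = of_rat g3 / (a * of_rat r)
              \<longrightarrow>
              (\<exists>a' b' c' d' :: rat.
                 a = of_rat a' \<and> b = of_rat b' \<and> c = of_rat c' \<and> d = of_rat d' \<and>
                 is_Dq_quadruple q a' b' c' d' \<and> a' * b' * c' * d' = m)))
     \<and>
     (\<forall>a b c d :: rat. \<forall>Q1\<in>E_points q m. \<forall>Q2\<in>E_points q m. \<forall>Q3\<in>E_points q m. \<forall>g123 :: rat.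
        is_Dq_quadruple q a b c d \<and> a * b * c * d = m \<and>
        corresponds_to q x1 y1 Q1 Q2 Q3 a b c d \<and>
        g_map q m x1 y1 (ec_add q m (ec_add q m Q1 Q2) Q3) = Some g123
        \<longrightarrow>
        is_square ((y1\<^sup>2 - q) * g123))"
proof (intro conjI allI ballI impI)
  note nonsing = assms(1-3) and D1 = assms(4)
  have m: "m = (x1\<^sup>2 - q) * (y1\<^sup>2 - q)"
    using D1 by (simp add: D_points_def)
  then have r: "x1\<^sup>2 - q \<noteq> 0"
    using nonsing by auto
  {
    fix Q1 Q2 Q3 g1 g2 g3 g123
    assume Q: "Q1 \<in> E_points q m" "Q2 \<in> E_points q m" "Q3 \<in> E_points q m"
      and H: "nondegenerate q m x1 y1 Q1 Q2 Q3 \<and>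
        g_map q m x1 y1 Q1 = Some g1 \<and> g1 \<noteq> 0 \<and>
        g_map q m x1 y1 Q2 = Some g2 \<and> g2 \<noteq> 0 \<and>
        g_map q m x1 y1 Q3 = Some g3 \<and> g3 \<noteq> 0 \<and>
        g_map q m x1 y1 (ec_add q m (ec_add q m Q1 Q2) Q3) = Some g123 \<and>
        is_square ((y1\<^sup>2 - q) * g123)"
    then have g: "g_map q m x1 y1 Q1 = Some g1" "g_map q m x1 y1 Q2 = Some g2"
        "g_map q m x1 y1 Q3 = Some g3"
      and g0: "g1 \<noteq> 0" "g2 \<noteq> 0" "g3 \<noteq> 0"
      and g123: "g_map q m x1 y1 (ec_add q m (ec_add q m Q1 Q2) Q3) = Some g123"
      and sq: "is_square ((y1\<^sup>2 - q) * g123)" and nd: "nondegenerate q m x1 y1 Q1 Q2 Q3"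
      by simp_all
    obtain u1 v1 where 1: "(u1, v1) \<in> D_points q m" "Q1 = f_map q x1 y1 (Affine u1 v1)"
        "g1 / (x1\<^sup>2 - q) = u1\<^sup>2 - q"
      using g_map_affineE[OF nonsing(2) D1 g(1) g0(1)] .
    obtain u2 v2 where 2: "(u2, v2) \<in> D_points q m" "Q2 = f_map q x1 y1 (Affine u2 v2)"
        "g2 / (x1\<^sup>2 - q) = u2\<^sup>2 - q"
      using g_map_affineE[OF nonsing(2) D1 g(2) g0(2)] .
    obtain u3 v3 where 3: "(u3, v3) \<in> D_points q m" "Q3 = f_map q x1 y1 (Affine u3 v3)"
        "g3 / (x1\<^sup>2 - q) = u3\<^sup>2 - q"
      using g_map_affineE[OF nonsing(2) D1 g(3) g0(3)] .
    note disj = nd[unfolded nondegenerate_def 1(2) 2(2) 3(2), THEN conjunct1]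
      nd[unfolded nondegenerate_def 1(2) 2(2) 3(2), THEN conjunct2, THEN conjunct1]
      nd[unfolded nondegenerate_def 1(2) 2(2) 3(2), THEN conjunct2, THEN conjunct2]
    have ne: "u1\<^sup>2 \<noteq> u2\<^sup>2" "u1\<^sup>2 \<noteq> u3\<^sup>2" "u2\<^sup>2 \<noteq> u3\<^sup>2" "u1\<^sup>2 \<noteq> v2\<^sup>2" "u1\<^sup>2 \<noteq> v3\<^sup>2" "u2\<^sup>2 \<noteq> v3\<^sup>2"
      using nondegenerate_D_points[OF nonsing D1 1(1) 2(1) disj(1)]
        nondegenerate_D_points[OF nonsing D1 1(1) 3(1) disj(2)]
        nondegenerate_D_points[OF nonsing D1 2(1) 3(1) disj(3)] by blast+
    define z where "z = 1 / m * (g1 / (x1\<^sup>2 - q)) * (g2 / (x1\<^sup>2 - q)) * (g3 / (x1\<^sup>2 - q))"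
    have "is_square ((y1\<^sup>2 - q) * (g1 * g2 * g3))"
      using is_square_g_map_sum[OF nonsing(2) D1 Q descent_g_map[OF nonsing(2) D1 g(1) g0(1)]
        descent_g_map[OF nonsing(2) D1 g(2) g0(2)] descent_g_map[OF nonsing(2) D1 g(3) g0(3)] g0 g123]
        sq by simp
    \<comment> \<open>This is \<open>m z (x1^2 - q)^3 = g1 g2 g3\<close> multiplied by
      \<open>y1^2 - q\<close>, with one factor \<open>m\<close> collected.\<close>
    also have "(y1\<^sup>2 - q) * (g1 * g2 * g3) = (m * (x1\<^sup>2 - q))\<^sup>2 * z"
    proof -
      have "m * z * (x1\<^sup>2 - q) ^ 3 = g1 * g2 * g3"
        using r nonsing(2) by (simp add: z_def power3_eq_cube)
      then show ?thesis unfolding m by algebra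
    qed
    finally have "is_square z"
      by (subst (asm) is_square_mult_cancel) (use r nonsing(2) in simp_all)
    then obtain s where s: "z = s\<^sup>2"
      by (auto simp: is_nth_power_def)
    \<comment> \<open>Any rational root \<open>t\<close> of \<open>z\<close> is allowed, so both
      signs and the branch of \<open>csqrt\<close> are covered.\<close>
    have quad: "is_Dq_quadruple q t ((u1\<^sup>2 - q) / t) ((u2\<^sup>2 - q) / t) ((u3\<^sup>2 - q) / t)"
      "t * ((u1\<^sup>2 - q) / t) * ((u2\<^sup>2 - q) / t) * ((u3\<^sup>2 - q) / t) = m" if "t\<^sup>2 = z" for t
    proof -
      have "m * t\<^sup>2 = (u1\<^sup>2 - q) * (u2\<^sup>2 - q) * (u3\<^sup>2 - q)"
        using nonsing(2) unfolding that z_def 1(3) 2(3) 3(3) by simp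
      from is_Dq_quadruple_of_D_points[OF nonsing(2) 1(1) 2(1) 3(1) ne this]
      show "is_Dq_quadruple q t ((u1\<^sup>2 - q) / t) ((u2\<^sup>2 - q) / t) ((u3\<^sup>2 - q) / t)"
        "t * ((u1\<^sup>2 - q) / t) * ((u2\<^sup>2 - q) / t) * ((u3\<^sup>2 - q) / t) = m" .
    qed
    have main: "\<exists>a' b' c' d'. a = of_rat a' \<and> b = of_rat b' \<and> c = of_rat c' \<and> d = of_rat d' \<and>
        is_Dq_quadruple q a' b' c' d' \<and> a' * b' * c' * d' = m"
      if H: "(a = csqrt (of_rat z) \<or> a = - csqrt (of_rat z)) \<and> b = of_rat g1 / (a * of_rat (x1\<^sup>2 - q)) \<and>
        c = of_rat g2 / (a * of_rat (x1\<^sup>2 - q)) \<and> d = of_rat g3 / (a * of_rat (x1\<^sup>2 - q))"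
      for a b c d :: complex
    proof -
      have "a = of_rat s \<or> a = of_rat (- s)"
        using H csqrt_of_rat_square[of s] unfolding s of_rat_minus by auto
      then obtain t where t: "a = of_rat t" "t\<^sup>2 = z"
        using s by force
      have "of_rat g / (a * of_rat (x1\<^sup>2 - q)) = (of_rat (g / (x1\<^sup>2 - q) / t) :: complex)" for g
        unfolding t(1) by (simp only: of_rat_divide of_rat_mult divide_divide_eq_left mult.commute)
      then have "b = of_rat ((u1\<^sup>2 - q) / t)" "c = of_rat ((u2\<^sup>2 - q) / t)" "d = of_rat ((u3\<^sup>2 - q) / t)"
        using H unfolding 1(3)[symmetric] 2(3)[symmetric] 3(3)[symmetric] by simp_all
      then show ?thesis
        using t(1) quad[OF t(2)] by blast
    qed
    then show "let r = x1\<^sup>2 - q; z = csqrt (of_rat (1 / m * (g1 / r) * (g2 / r) * (g3 / r)))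
      in \<forall>a b c d :: complex.
        (a = z \<or> a = - z) \<and> b = of_rat g1 / (a * of_rat r) \<and> c = of_rat g2 / (a * of_rat r) \<and>
        d = of_rat g3 / (a * of_rat r) \<longrightarrow>
        (\<exists>a' b' c' d' :: rat. a = of_rat a' \<and> b = of_rat b' \<and> c = of_rat c' \<and> d = of_rat d' \<and>
          is_Dq_quadruple q a' b' c' d' \<and> a' * b' * c' * d' = m)"
      unfolding Let_def z_def[symmetric] by blast
  next
    fix a b c d Q1 Q2 Q3 g123
    assume Q: "Q1 \<in> E_points q m" "Q2 \<in> E_points q m" "Q3 \<in> E_points q m"
      and H: "is_Dq_quadruple q a b c d \<and> a * b * c * d = m \<and>
        corresponds_to q x1 y1 Q1 Q2 Q3 a b c d \<and>
        g_map q m x1 y1 (ec_add q m (ec_add q m Q1 Q2) Q3) = Some g123"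
    then have abcd: "a * b * c * d = m" by simp
    then have nz: "a \<noteq> 0" "b \<noteq> 0" "c \<noteq> 0" "d \<noteq> 0"
      using nonsing(2) by auto
    obtain t12 t13 t14 t23 t24 t34 where
      t: "a * b + q = t12\<^sup>2" "a * c + q = t13\<^sup>2" "a * d + q = t14\<^sup>2"
        "b * c + q = t23\<^sup>2" "b * d + q = t24\<^sup>2" "c * d + q = t34\<^sup>2"
      and f: "Q1 = f_map q x1 y1 (Affine t12 t34)" "Q2 = f_map q x1 y1 (Affine t13 t24)"
        "Q3 = f_map q x1 y1 (Affine t14 t23)"
      using H unfolding corresponds_to_def by blast
    have D: "(t12, t34) \<in> D_points q m" "(t13, t24) \<in> D_points q m" "(t14, t23) \<in> D_points q m"
      using abcd by (simp_all add: D_points_def t[symmetric] mult_ac)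
    have e: "t12\<^sup>2 - q = a * b" "t13\<^sup>2 - q = a * c" "t14\<^sup>2 - q = a * d"
      by (simp_all add: t[symmetric])
    \<comment> \<open>The values are read off at the given preimages \<open>(t12, t34)\<close>,
      \<open>(t13, t24)\<close> and \<open>(t14, t23)\<close>, independently of the preimages chosen
      by \<open>g_map\<close>.\<close>
    have "is_square ((y1\<^sup>2 - q) * g123) \<longleftrightarrow>
      is_square ((y1\<^sup>2 - q) * ((x1\<^sup>2 - q) * (a * b) * ((x1\<^sup>2 - q) * (a * c)) * ((x1\<^sup>2 - q) * (a * d))))"
    proof (rule is_square_g_map_sum[OF nonsing(2) D1 Q])
      show "is_square (descent Q1 * ((x1\<^sup>2 - q) * (a * b)))"
        "is_square (descent Q2 * ((x1\<^sup>2 - q) * (a * c)))"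
        "is_square (descent Q3 * ((x1\<^sup>2 - q) * (a * d)))"
        unfolding f e[symmetric] using descent_f_map[OF nonsing(2) D1] D by blast+
    qed (use H r nz in auto)
    also have "(y1\<^sup>2 - q) * ((x1\<^sup>2 - q) * (a * b) * ((x1\<^sup>2 - q) * (a * c)) * ((x1\<^sup>2 - q) * (a * d))) =
        (m * ((x1\<^sup>2 - q) * a))\<^sup>2"
      using abcd m by algebra
    finally show "is_square ((y1\<^sup>2 - q) * g123)"
      by simp
  }
qed

end
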